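(* Let $K$ be a field, $n\ge1$ an integer, and $E$ a finite directed graph such that $L_K(E)\cong M_n(K)$ as $K$-algebras. Then the number of edges of $E$ is at least $$N_n:=\max\{N\in\mathbb{N}\mid n\ge SP^N_*\}.$$
   Context: A directed graph $E=(E^0,E^1,s,t)$ has vertices $E^0$, edges $E^1$ and source and target maps $s,t\colon E^1\to E^0$ (multiple edges allowed). A finite path of length $m\ge1$ is a tuple $(e_1,\dots,e_m)$ of edges with $t(e_i)=s(e_{i+1})$, ending at $t(e_m)$; vertices are paths of length $0$. A sink is a vertex emitting no edges. Acyclic means there is no path of positive length with equal beginning and end; connected means any two vertices are joined by an undirected path. For $N\in\mathbb{N}$, $SP^N_*$ denotes the maximal number of finite paths ending in the sink, over all connected acyclic directed graphs with exactly $N$ edges and exactly one sink (so $SP^0_*=1$, from a single vertex). For a finite directed graph $E$ and a field $K$, the Leavitt path algebra $L_K(E)$ is the universal associative $K$-algebra generated by $\{v: v\in E^0\}\cup\{e,e^*: e\in E^1\}$ with relations: $vw=\delta_{v,w}v$ for $v,w\in E^0$; $s(e)e=e=e\,t(e)$ and $t(e)e^*=e^*=e^*s(e)$ for $e\in E^1$; $e^*f=\delta_{e,f}t(e)$ for $e,f\in E^1$; and $v=\sum_{e\in s^{-1}(v)}ee^*$ for every vertex $v$ that is not a sink. *)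

theory Defs
  imports
    "Graph_Theory.Graph_Theory"
    "Jordan_Normal_Form.Matrix"
    "HOL-Algebra.QuotRing"
    "HOL-Library.Poly_Mapping"
begin

section \<open>Counting paths\<close>

definition sinks :: "('v, 'e) pre_digraph \<Rightarrow> 'v set" where
  "sinks G = {v \<in> verts G. out_arcs G v = {}}"

definition acyclic_digraph :: "('v, 'e) pre_digraph \<Rightarrow> bool" where
  "acyclic_digraph G \<longleftrightarrow> (\<nexists>u p. p \<noteq> [] \<and> pre_digraph.awalk G u p u)"

text \<open>A path is its starting vertex together with its list of arcs, so that the paths of
  length 0 are the pairs \<open>(u, [])\<close>.\<close>

definition paths_ending_in :: "('v, 'e) pre_digraph \<Rightarrow> 'v \<Rightarrow> ('v \<times> 'e list) set" where
  "paths_ending_in G w = {(u, p). pre_digraph.awalk G u p w}"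

text \<open>A connected graph with finitely many arcs is finite, so graphs on natural numbers
  represent all isomorphism classes; for each \<open>N\<close> there are finitely many of these, so the
  maximum is over a finite set (which is nonempty, as witnessed by a line).\<close>

definition SP_max :: "nat \<Rightarrow> nat" where
  "SP_max N = Max {card (paths_ending_in G w) | (G :: (nat, nat) pre_digraph) w.
     fin_digraph G \<and> Digraph_Component.connected G \<and> acyclic_digraph G \<and>
     card (arcs G) = N \<and> sinks G = {w}}"


section \<open>Free algebras\<close>

text \<open>Lists form the free monoid, so the finitely supported functions
  \<open>'g list \<Rightarrow>\<^sub>0 'k\<close> with the convolution product of \<open>Poly_Mapping\<close> are the free unital
  \<open>'k\<close>-algebra on \<open>'g\<close>.\<close>

instantiation list :: (type) monoid_add
begin

definition zero_list :: "'a list" where "0 = []"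

definition plus_list :: "'a list \<Rightarrow> 'a list \<Rightarrow> 'a list" where "xs + ys = xs @ ys"

instance by standard (simp_all add: zero_list_def plus_list_def)

end

definition gen :: "'g \<Rightarrow> ('g list \<Rightarrow>\<^sub>0 'k::field)" where
  "gen x = Poly_Mapping.single [x] 1"

definition scale :: "'k::field \<Rightarrow> ('g list \<Rightarrow>\<^sub>0 'k) \<Rightarrow> ('g list \<Rightarrow>\<^sub>0 'k)" where
  "scale c f = Poly_Mapping.single [] c * f"

text \<open>The free algebra without unit: only nonempty words occur.\<close>

definition free_alg :: "'g set \<Rightarrow> ('g list \<Rightarrow>\<^sub>0 'k::field) set" where
  "free_alg X = {f. \<forall>w \<in> Poly_Mapping.keys f. w \<noteq> [] \<and> set w \<subseteq> X}"

text \<open>The two-sided algebra ideal of \<open>free_alg X\<close> generated by \<open>R\<close>.\<close>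

inductive_set alg_ideal ::
    "'g set \<Rightarrow> ('g list \<Rightarrow>\<^sub>0 'k::field) set \<Rightarrow> ('g list \<Rightarrow>\<^sub>0 'k) set"
  for X R where
  zero: "0 \<in> alg_ideal X R"
| rel: "r \<in> R \<Longrightarrow> r \<in> alg_ideal X R"
| add: "f \<in> alg_ideal X R \<Longrightarrow> g \<in> alg_ideal X R \<Longrightarrow> f + g \<in> alg_ideal X R"
| smult: "f \<in> alg_ideal X R \<Longrightarrow> scale c f \<in> alg_ideal X R"
| lmult: "a \<in> free_alg X \<Longrightarrow> f \<in> alg_ideal X R \<Longrightarrow> a * f \<in> alg_ideal X R"
| rmult: "f \<in> alg_ideal X R \<Longrightarrow> a \<in> free_alg X \<Longrightarrow> f * a \<in> alg_ideal X R"


section \<open>Leavitt path algebras\<close>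

datatype ('v, 'e) lpa_gen = Vertex 'v | Edge 'e | Ghost 'e

definition lpa_gens :: "('v, 'e) pre_digraph \<Rightarrow> ('v, 'e) lpa_gen set" where
  "lpa_gens E = Vertex ` verts E \<union> Edge ` arcs E \<union> Ghost ` arcs E"

abbreviation vx :: "'v \<Rightarrow> (('v, 'e) lpa_gen list \<Rightarrow>\<^sub>0 'k::field)" where
  "vx v \<equiv> gen (Vertex v)"

abbreviation ed :: "'e \<Rightarrow> (('v, 'e) lpa_gen list \<Rightarrow>\<^sub>0 'k::field)" where
  "ed e \<equiv> gen (Edge e)"

abbreviation gh :: "'e \<Rightarrow> (('v, 'e) lpa_gen list \<Rightarrow>\<^sub>0 'k::field)" where
  "gh e \<equiv> gen (Ghost e)"

text \<open>A relation \<open>a = b\<close> is represented by \<open>a - b\<close>. The source of an arc is its tail, the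
  target its head.\<close>

definition lpa_rels :: "('v, 'e) pre_digraph \<Rightarrow> (('v, 'e) lpa_gen list \<Rightarrow>\<^sub>0 'k::field) set" where
  "lpa_rels E =
     {vx v * vx w - (if v = w then vx v else 0) | v w. v \<in> verts E \<and> w \<in> verts E}
   \<union> {vx (tail E e) * ed e - ed e | e. e \<in> arcs E}
   \<union> {ed e * vx (head E e) - ed e | e. e \<in> arcs E}
   \<union> {vx (head E e) * gh e - gh e | e. e \<in> arcs E}
   \<union> {gh e * vx (tail E e) - gh e | e. e \<in> arcs E}
   \<union> {gh e * ed f - (if e = f then vx (head E e) else 0) | e f. e \<in> arcs E \<and> f \<in> arcs E}
   \<union> {vx v - (\<Sum>e \<in> out_arcs E v. ed e * gh e) | v. v \<in> verts E \<and> v \<notin> sinks E}"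

definition lpa_cong ::
    "('v, 'e) pre_digraph \<Rightarrow> (('v, 'e) lpa_gen list \<Rightarrow>\<^sub>0 'k::field) rel" where
  "lpa_cong E = {(f, g). f \<in> free_alg (lpa_gens E) \<and> g \<in> free_alg (lpa_gens E) \<and>
                         f - g \<in> alg_ideal (lpa_gens E) (lpa_rels E)}"

text \<open>As an algebra without prescribed unit, \<open>leavitt E\<close> is the quotient of the free algebra;
  the field \<open>one\<close> records the sum of the vertices, which is the unit when \<open>E\<close> is finite.\<close>

definition leavitt :: "('v, 'e) pre_digraph \<Rightarrow>
    ('k::field, (('v, 'e) lpa_gen list \<Rightarrow>\<^sub>0 'k) set) module" where
  "leavitt E = \<lparr>
     carrier = free_alg (lpa_gens E) // lpa_cong E,
     mult = (\<lambda>A B. \<Union>a \<in> A. \<Union>b \<in> B. lpa_cong E `` {a * b}),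
     one = lpa_cong E `` {\<Sum>v \<in> verts E. vx v},
     zero = lpa_cong E `` {0},
     add = (\<lambda>A B. \<Union>a \<in> A. \<Union>b \<in> B. lpa_cong E `` {a + b}),
     smult = (\<lambda>c A. \<Union>a \<in> A. lpa_cong E `` {scale c a})\<rparr>"

definition alg_iso :: "('k, 'a, 'm) module_scheme \<Rightarrow> ('k, 'b, 'n) module_scheme \<Rightarrow> bool" where
  "alg_iso A B \<longleftrightarrow> (\<exists>h \<in> ring_iso A B. \<forall>c. \<forall>x \<in> carrier A.
     h (c \<odot>\<^bsub>A\<^esub> x) = c \<odot>\<^bsub>B\<^esub> h x)"

end

theory Submission
  imports Defs "HOL-Library.Function_Algebras"
begin

text \<open>
  Write \<open>L\<close> for the Leavitt path algebra and let \<open>F\<close> be the subgraph of \<open>E\<close> on the vertices that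
  are nonzero in \<open>L\<close>. The defining relations are homogeneous for \<open>deg e = 1\<close>, \<open>deg e* = -1\<close>, so
  \<open>L\<close> is graded; since \<open>L\<close> is finite dimensional, only finitely many degrees are nonzero. The powers
  of a cycle \<open>c\<close> in \<open>F\<close> have distinct degrees and are nonzero because \<open>c* c\<close> is a vertex, so \<open>F\<close> is
  acyclic. Then the relation \<open>v = \<Sum> e e*\<close>, applied until every path has reached a sink, shows that
  \<open>L\<close> is spanned by the monomials \<open>p q*\<close> with \<open>p\<close>, \<open>q\<close> paths in \<open>F\<close> ending in the same sink. For
  distinct sinks \<open>s\<close>, \<open>t\<close> this gives \<open>s L t = 0\<close>, which is impossible in the prime ring of matrices;
  hence \<open>F\<close> has exactly one sink, and comparing dimensions bounds \<open>n\<close> by the number of paths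
  ending in it. Finally, \<open>SP_max\<close> is strictly increasing, because an arc from the sink to a new
  vertex prolongs every path and adds a trivial one.
\<close>

section \<open>Path counts\<close>

lemma (in wf_digraph) acyclic_digraph_iff: "acyclic_digraph G \<longleftrightarrow> acyclic (arcs_ends G)"
  unfolding acyclic_digraph_def acyclic_def using reachable1_awalk by auto

lemma (in fin_digraph) finite_arcs_ends: "finite (arcs_ends G)"
  by (simp add: arcs_ends_def)

text \<open>By finiteness and acyclicity the converse of the arc relation is well-founded, so a
  property can be pulled back from the heads of all arcs leaving a vertex, with the sinks as base
  case.\<close>

lemma (in fin_digraph) acyclic_sink_induct [consumes 2, case_names sink step]:
  assumes "acyclic_digraph G" and "v \<in> verts G"
    and sink: "\<And>v. v \<in> sinks G \<Longrightarrow> P v"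
    and step: "\<And>v. v \<in> verts G \<Longrightarrow> v \<notin> sinks G \<Longrightarrow> (\<And>e. e \<in> out_arcs G v \<Longrightarrow> P (head G e)) \<Longrightarrow> P v"
  shows "P v"
proof -
  have "wf ((arcs_ends G)\<inverse>)"
    using assms(1) finite_arcs_ends finite_acyclic_wf_converse acyclic_digraph_iff by blast
  from this and \<open>v \<in> verts G\<close> show ?thesis
  proof (induction v rule: wf_induct_rule)
    case (less v)
    then have "P (head G e)" if "e \<in> out_arcs G v" for e
      using that by (auto simp: arcs_ends_conv)
    then show ?case
      using less.prems sink step by blast
  qed
qed

lemma (in fin_digraph) acyclic_reaches_sink:
  assumes "acyclic_digraph G" and "v \<in> verts G"
  shows "\<exists>w p. w \<in> sinks G \<and> awalk v p w"
  using assms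
proof (induction rule: acyclic_sink_induct)
  case (sink v)
  then have "awalk v [] v" by (simp add: sinks_def awalk_Nil_iff)
  with sink show ?case by blast
next
  case (step v)
  then obtain e where e: "e \<in> out_arcs G v" unfolding sinks_def by blast
  then obtain w p where "w \<in> sinks G" "awalk (head G e) p w" using step by blast
  with e have "awalk v (e # p) w" by (auto simp: awalk_Cons_iff)
  with \<open>w \<in> sinks G\<close> show ?case by blast
qed

text \<open>Every vertex has a walk to the one sink, so any two vertices are joined through
  it.\<close>

lemma (in fin_digraph) acyclic_single_sink_connected:
  assumes "acyclic_digraph G" and "sinks G = {w}"
  shows "Digraph_Component.connected G"
proof -
  let ?R = "rtrancl_on (verts G) ((arcs_ends G)\<^sup>s)"
  have w: "w \<in> verts G" using assms(2) by (auto simp: sinks_def)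
  have to: "(v, w) \<in> ?R" if "v \<in> verts G" for v
  proof -
    from acyclic_reaches_sink[OF assms(1) that] assms(2) have "v \<rightarrow>\<^sup>* w"
      by (auto simp: reachable_awalk)
    then show ?thesis
      unfolding reachable_def by (rule rtrancl_on_mono[rotated 2]) (auto simp: symcl_def)
  qed
  have "sym ?R" by (rule rtrancl_on_sym) (auto simp: symcl_def sym_def)
  then have "(w, v) \<in> ?R" if "v \<in> verts G" for v using to[OF that] by (rule symD)
  with to w show ?thesis unfolding connected_conv by (blast intro: rtrancl_on_trans)
qed

text \<open>Every vertex other than \<open>w\<close> is the tail of some arc.\<close>

lemma (in fin_digraph) card_verts_single_sink:
  assumes "sinks G = {w}"
  shows "card (verts G) \<le> Suc (card (arcs G))"
proof -
  have "verts G \<subseteq> insert w (tail G ` arcs G)"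
    using assms by (auto simp: sinks_def out_arcs_def)
  then have "card (verts G) \<le> card (insert w (tail G ` arcs G))"
    by (intro card_mono) auto
  also have "\<dots> \<le> Suc (card (tail G ` arcs G))" by (rule card_insert_le_m1) auto
  also have "\<dots> \<le> Suc (card (arcs G))" by (simp add: card_image_le)
  finally show ?thesis .
qed

text \<open>A repeated vertex would cut out a nonempty closed subwalk.\<close>

lemma (in fin_digraph) acyclic_awalk_apath:
  assumes "acyclic_digraph G" and "awalk u p v"
  shows "apath u p v"
proof (rule ccontr)
  assume "\<not> apath u p v"
  then have "\<not> distinct (awalk_verts u p)" using assms(2) by (simp add: apath_def)
  from awalk_not_distinct_decomp[OF assms(2) this] show False
    using assms(1) by (auto simp: acyclic_digraph_def)
qed

text \<open>A walk repeats no vertex, so by the vertex count its length is at most the number of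
  arcs. The crude bound depends on that number alone, which makes the set of path counts in
  \<open>SP_max\<close> finite.\<close>

lemma (in fin_digraph) paths_ending_in_bound:
  assumes "acyclic_digraph G" and "sinks G = {w}"
  shows "finite (paths_ending_in G w)"
    and "card (paths_ending_in G w) \<le>
      Suc (card (arcs G)) * (\<Sum>i\<le>card (arcs G). card (arcs G) ^ i)"
proof -
  let ?N = "card (arcs G)"
  let ?L = "{p. set p \<subseteq> arcs G \<and> length p \<le> ?N}"
  have sub: "paths_ending_in G w \<subseteq> verts G \<times> ?L"
  proof (clarsimp simp: paths_ending_in_def)
    fix u p assume p: "awalk u p w"
    from length_apath_less[OF acyclic_awalk_apath[OF assms(1) p]]
    have "length p \<le> ?N" using card_verts_single_sink[OF assms(2)] by simp
    with p show "u \<in> verts G \<and> set p \<subseteq> arcs G \<and> length p \<le> ?N"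
      by (auto simp: awalk_def)
  qed
  have fin: "finite (verts G \<times> ?L)" by (simp add: finite_lists_length_le)
  from sub fin show "finite (paths_ending_in G w)" by (rule finite_subset)
  have "card (paths_ending_in G w) \<le> card (verts G \<times> ?L)" using fin sub by (rule card_mono)
  also have "\<dots> = card (verts G) * (\<Sum>i\<le>?N. ?N ^ i)"
    by (simp add: card_cartesian_product card_lists_length_le)
  also have "\<dots> \<le> Suc ?N * (\<Sum>i\<le>?N. ?N ^ i)"
    using card_verts_single_sink[OF assms(2)] by (intro mult_right_mono) auto
  finally show "card (paths_ending_in G w) \<le> Suc ?N * (\<Sum>i\<le>?N. ?N ^ i)" .
qed

section \<open>Attainment and strict growth of the maximal path count\<close>

abbreviation single_sink_graph :: "('v, 'e) pre_digraph \<Rightarrow> nat \<Rightarrow> 'v \<Rightarrow> bool" where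
  "single_sink_graph G N w \<equiv>
     fin_digraph G \<and> acyclic_digraph G \<and> card (arcs G) = N \<and> sinks G = {w}"

lemma single_sink_graph_zero:
  fixes v :: 'v
  shows "single_sink_graph (\<lparr>verts = {v}, arcs = {}, tail = t, head = h\<rparr> :: ('v, 'e) pre_digraph) 0 v"
    (is "single_sink_graph ?G 0 v")
proof -
  interpret fin_digraph ?G by unfold_locales auto
  have "acyclic_digraph ?G" by (auto simp: acyclic_digraph_iff acyclic_def arcs_ends_def)
  then show ?thesis using fin_digraph by (auto simp: sinks_def out_arcs_def)
qed

lemma single_sink_graph_extend:
  fixes G :: "('v, 'e) pre_digraph"
  assumes G: "single_sink_graph G N w" and v: "v \<notin> verts G" and a: "a \<notin> arcs G"
  defines "H \<equiv> \<lparr>verts = insert v (verts G), arcs = insert a (arcs G),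
    tail = (tail G)(a := w), head = (head G)(a := v)\<rparr>"
  shows "single_sink_graph H (Suc N) v"
    and "card (paths_ending_in G w) < card (paths_ending_in H v)"
proof -
  interpret G: fin_digraph G using G by blast
  have w: "w \<in> verts G" using G by (auto simp: sinks_def)
  have [simp]: "verts H = insert v (verts G)" "arcs H = insert a (arcs G)"
    "tail H = (tail G)(a := w)" "head H = (head G)(a := v)"
    by (simp_all add: H_def)
  interpret H: fin_digraph H
    by unfold_locales (use w in auto)
  have ends: "arcs_ends H = insert (w, v) (arcs_ends G)"
    using a by (auto simp: arcs_ends_conv image_iff)
  \<comment> \<open>The new arc from \<open>w\<close> to \<open>v\<close> closes a cycle only if
    \<open>v\<close> reaches \<open>w\<close> in \<open>G\<close>; but \<open>v\<close> is not a
    vertex of \<open>G\<close>, so it differs from \<open>w\<close> and no arc of \<open>G\<close>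
    starts there.\<close>
  have "(v, w) \<notin> (arcs_ends G)\<^sup>*"
  proof
    assume "(v, w) \<in> (arcs_ends G)\<^sup>*"
    then show False using v w by (cases rule: converse_rtranclE) (auto simp: arcs_ends_conv)
  qed
  then have ac: "acyclic_digraph H"
    using G by (simp add: H.acyclic_digraph_iff G.acyclic_digraph_iff ends)
  have "sinks H = {v}"
  proof -
    have "out_arcs H u \<noteq> {}" if u: "u \<in> verts G" for u
    proof (cases "u = w")
      case True then show ?thesis by (auto simp: out_arcs_def)
    next
      case False
      then have "u \<notin> sinks G" using G by blast
      then obtain b where "b \<in> arcs G" "tail G b = u"
        using u unfolding sinks_def out_arcs_def by blast
      then show ?thesis using a by (auto simp: out_arcs_def)
    qed
    moreover have "out_arcs H v = {}" using v w by (auto simp: out_arcs_def)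
    ultimately show ?thesis by (auto simp: sinks_def)
  qed
  with ac show H: "single_sink_graph H (Suc N) v"
    using G a H.fin_digraph by simp
  have walk: "H.awalk u p w" if "G.awalk u p w" for u p
    using that
  proof (induction p arbitrary: u)
    case Nil then show ?case by (auto simp: G.awalk_Nil_iff H.awalk_Nil_iff)
  next
    case (Cons b p)
    then have "b \<noteq> a" using a by (auto simp: G.awalk_Cons_iff)
    with Cons show ?case by (auto simp: G.awalk_Cons_iff H.awalk_Cons_iff)
  qed
  let ?f = "\<lambda>(u, p). (u, p @ [a])"
  have "H.awalk w [a] v" by (simp add: H.awalk_simps)
  then have "insert (v, []) (?f ` paths_ending_in G w) \<subseteq> paths_ending_in H v"
    unfolding paths_ending_in_def
    by (auto simp: H.awalk_Nil_iff dest!: walk intro: H.awalk_appendI)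
  then have "card (insert (v, []) (?f ` paths_ending_in G w)) \<le> card (paths_ending_in H v)"
    using H H.paths_ending_in_bound(1) by (intro card_mono) auto
  moreover have "card (insert (v, []) (?f ` paths_ending_in G w)) = Suc (card (paths_ending_in G w))"
  proof -
    have "inj_on ?f (paths_ending_in G w)" by (auto simp: inj_on_def)
    then have "card (?f ` paths_ending_in G w) = card (paths_ending_in G w)" by (rule card_image)
    moreover have "finite (paths_ending_in G w)" using G G.paths_ending_in_bound(1) by blast
    ultimately show ?thesis by (subst card_insert_disjoint) auto
  qed
  ultimately show "card (paths_ending_in G w) < card (paths_ending_in H v)" by simp
qed

lemma SP_max_alt:
  "SP_max N = Max {card (paths_ending_in G w) | (G :: (nat, nat) pre_digraph) w. single_sink_graph G N w}"
  unfolding SP_max_def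
  by (intro arg_cong[where f = Max] Collect_cong arg_cong[where f = Ex] ext)
    (auto simp: fin_digraph.acyclic_single_sink_connected)

lemma finite_path_counts:
  "finite {card (paths_ending_in G w) | (G :: ('v, 'e) pre_digraph) w. single_sink_graph G N w}"
proof (rule finite_subset)
  show "{card (paths_ending_in G w) | (G :: ('v, 'e) pre_digraph) w. single_sink_graph G N w} \<subseteq>
      {..Suc N * (\<Sum>i\<le>N. N ^ i)}"
  proof
    fix x assume "x \<in> {card (paths_ending_in G w) | (G :: ('v, 'e) pre_digraph) w. single_sink_graph G N w}"
    then obtain G :: "('v, 'e) pre_digraph" and w
      where "x = card (paths_ending_in G w)" "single_sink_graph G N w"
      by blast
    then show "x \<in> {..Suc N * (\<Sum>i\<le>N. N ^ i)}"
      using fin_digraph.paths_ending_in_bound(2)[of G w] by simp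
  qed
qed simp

lemma SP_max_geI:
  assumes "single_sink_graph (G :: (nat, nat) pre_digraph) N w"
  shows "card (paths_ending_in G w) \<le> SP_max N"
  unfolding SP_max_alt using assms by (intro Max_ge[OF finite_path_counts]) blast

text \<open>Nonemptiness, together with \<open>finite_path_counts\<close>, makes \<open>Max\<close>
  an attained value. The witness grows from a single vertex by repeated extension at the
  sink.\<close>

lemma ex_single_sink_graph: "\<exists>(G :: (nat, nat) pre_digraph) w. single_sink_graph G N w"
proof (induction N)
  case 0
  show ?case by (intro exI) (rule single_sink_graph_zero)
next
  case (Suc N)
  then obtain G :: "(nat, nat) pre_digraph" and w where G: "single_sink_graph G N w" by (elim exE)
  then have "finite (verts G)" "finite (arcs G)"
    by (simp_all add: fin_digraph_def fin_digraph_axioms_def)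
  then obtain v a where "v \<notin> verts G" "a \<notin> arcs G" by (meson ex_new_if_finite infinite_UNIV_nat)
  from single_sink_graph_extend(1)[OF G this] show ?case by (intro exI)
qed

lemma SP_max_attained:
  obtains G :: "(nat, nat) pre_digraph" and w
  where "single_sink_graph G N w" and "card (paths_ending_in G w) = SP_max N"
proof -
  let ?C = "{card (paths_ending_in G w) | (G :: (nat, nat) pre_digraph) w. single_sink_graph G N w}"
  have "Max ?C \<in> ?C"
    using ex_single_sink_graph[of N] by (intro Max_in finite_path_counts) auto
  then have "SP_max N \<in> ?C" unfolding SP_max_alt .
  then obtain G :: "(nat, nat) pre_digraph" and w
    where "single_sink_graph G N w" "SP_max N = card (paths_ending_in G w)"
    by blast
  then show thesis using that by simp
qed

lemma strict_mono_SP_max: "strict_mono SP_max"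
proof (rule strict_mono_Suc_iff[THEN iffD2, rule_format])
  fix N
  obtain G :: "(nat, nat) pre_digraph" and w
    where G: "single_sink_graph G N w" and card: "card (paths_ending_in G w) = SP_max N"
    by (rule SP_max_attained)
  then have "finite (verts G)" "finite (arcs G)"
    by (simp_all add: fin_digraph_def fin_digraph_axioms_def)
  then obtain v a where "v \<notin> verts G" "a \<notin> arcs G" by (meson ex_new_if_finite infinite_UNIV_nat)
  from single_sink_graph_extend[OF G this] show "SP_max N < SP_max (Suc N)"
    using SP_max_geI[of _ "Suc N" v] card by (metis (no_types, lifting) order_less_le_trans)
qed

lemma SP_max_0: "SP_max 0 = 1"
proof -
  obtain G :: "(nat, nat) pre_digraph" and w
    where G: "single_sink_graph G 0 w" and card: "card (paths_ending_in G w) = SP_max 0"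
    by (rule SP_max_attained)
  interpret fin_digraph G using G by blast
  have "arcs G = {}" "w \<in> verts G" using G by (auto simp: sinks_def)
  then have "paths_ending_in G w = {(w, [])}" by (auto simp: paths_ending_in_def awalk_def)
  with card show ?thesis by simp
qed

text \<open>\<open>SP_max\<close> only sees graphs on natural numbers, so \<open>G\<close> is
  relabelled injectively and its paths are carried along.\<close>

lemma (in fin_digraph) card_paths_le_SP_max:
  assumes "acyclic_digraph G" and "sinks G = {w}"
  shows "card (paths_ending_in G w) \<le> SP_max (card (arcs G))"
proof -
  obtain f :: "'a \<Rightarrow> nat" where f: "inj_on f (verts G)"
    using finite_imp_inj_to_nat_seg[OF finite_verts] by blast
  obtain g :: "'b \<Rightarrow> nat" where g: "inj_on g (arcs G)"
    using finite_imp_inj_to_nat_seg[OF finite_arcs] by blast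
  \<comment> \<open>The new head and tail maps act on the relabelled arcs, hence the inverse of
    \<open>g\<close> on \<open>arcs G\<close>.\<close>
  define h where "h = \<lparr>iso_verts = f, iso_arcs = g,
    iso_head = f \<circ> head G \<circ> the_inv_into (arcs G) g,
    iso_tail = f \<circ> tail G \<circ> the_inv_into (arcs G) g\<rparr>"
  have h: "digraph_isomorphism h"
    using f g wf_digraph by (auto simp: digraph_isomorphism_def h_def the_inv_into_f_f)
  interpret H: fin_digraph "app_iso h G" using h ..
  let ?i = "\<lambda>(u, p). (iso_verts h u, map (iso_arcs h) p)"
  have "sinks (app_iso h G) = iso_verts h ` sinks G"
    using h by (auto simp: sinks_def out_arcs_app_iso_eq)
  then have "sinks (app_iso h G) = {iso_verts h w}" using assms(2) by simp
  moreover have "acyclic_digraph (app_iso h G)"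
    unfolding acyclic_digraph_def
  proof clarify
    fix u p assume "p \<noteq> []" "H.awalk u p u"
    then have "map (iso_arcs (inv_iso h)) p \<noteq> []" by simp
    \<comment> \<open>A closed walk in the relabelled graph is transported back to one in
      \<open>G\<close>.\<close>
    with awalk_app_isoD[OF \<open>H.awalk u p u\<close> h] assms(1) show False
      unfolding acyclic_digraph_def by blast
  qed
  moreover have "card (arcs (app_iso h G)) = card (arcs G)"
    using g by (simp add: h_def card_image)
  ultimately have G: "single_sink_graph (app_iso h G) (card (arcs G)) (iso_verts h w)"
    using H.fin_digraph by simp
  have "?i ` paths_ending_in G w \<subseteq> paths_ending_in (app_iso h G) (iso_verts h w)"
    using awalk_app_isoI[OF _ h] by (auto simp: paths_ending_in_def)
  moreover have "inj_on ?i (paths_ending_in G w)"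
  proof -
    have "inj_on (map g) {p. set p \<subseteq> arcs G}"
      by (rule inj_on_mapI, rule inj_on_subset[OF g]) auto
    then have "inj_on (map_prod f (map g)) (verts G \<times> {p. set p \<subseteq> arcs G})"
      using f by (rule map_prod_inj_on[rotated])
    moreover have "paths_ending_in G w \<subseteq> verts G \<times> {p. set p \<subseteq> arcs G}"
      by (auto simp: paths_ending_in_def awalk_def)
    ultimately show ?thesis
      unfolding h_def map_prod_def by (simp add: inj_on_subset)
  qed
  ultimately have "card (paths_ending_in G w) \<le> card (paths_ending_in (app_iso h G) (iso_verts h w))"
    using G H.paths_ending_in_bound(1) by (intro card_inj_on_le[where f = ?i]) auto
  also have "\<dots> \<le> SP_max (card (arcs G))" using G by (rule SP_max_geI)
  finally show ?thesis .
qed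

section \<open>Ideals of free algebras\<close>

lemma single_mult_single [simp]:
  "Poly_Mapping.single v a * Poly_Mapping.single w b = Poly_Mapping.single (v @ w) (a * b)"
  by (simp add: mult_single plus_list_def)

lemma single_Nil_one: "Poly_Mapping.single [] 1 = 1"
  by (metis single_one zero_list_def)

lemma gen_mult_gen: "gen x * gen y = Poly_Mapping.single [x, y] 1"
  by (simp add: gen_def)

lemma vector_space_scale: "vector_space scale"
  by unfold_locales
    (simp_all add: scale_def single_add distrib_left distrib_right mult.assoc [symmetric] single_Nil_one)

interpretation free: vector_space scale
  by (rule vector_space_scale)

lemma update_eq_add_single:
  "w \<notin> Poly_Mapping.keys f \<Longrightarrow> Poly_Mapping.update w c f = f + Poly_Mapping.single w c"
  by (intro poly_mapping_eqI) (auto simp: lookup_update lookup_add lookup_single when_def in_keys_iff)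

lemma free_alg_induct [consumes 1, case_names zero add]:
  assumes "f \<in> free_alg X" and "P 0"
    and add: "\<And>f w c. f \<in> free_alg X \<Longrightarrow> P f \<Longrightarrow> w \<noteq> [] \<Longrightarrow> set w \<subseteq> X \<Longrightarrow> P (f + Poly_Mapping.single w c)"
  shows "P f"
  using assms(1)
proof (induction f rule: update_induct)
  case const
  then show ?case using \<open>P 0\<close> by simp
next
  case (update f w c)
  have eq: "Poly_Mapping.update w c f = f + Poly_Mapping.single w c"
    using update(1) by (rule update_eq_add_single)
  have "f \<in> free_alg X" "w \<noteq> []" "set w \<subseteq> X"
    using update(2,4) by (auto simp: free_alg_def keys_update)
  then show ?case using update.IH add unfolding eq by blast
qed

text \<open>\<open>scale\<close> multiplies from the left by a constant on the empty word. Such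
  constants are central: the empty word commutes with every word, and the field is
  commutative.\<close>

lemma mult_scale: "f * scale c g = scale c (f * g)"
proof (induction f rule: update_induct)
  case (update f w b)
  have eq: "Poly_Mapping.update w b f = f + Poly_Mapping.single w b"
    using update(1) by (rule update_eq_add_single)
  have "Poly_Mapping.single w b * scale c g = scale c (Poly_Mapping.single w b * g)"
    by (simp add: scale_def mult.assoc [symmetric] mult.commute)
  with update(3) show ?case by (simp add: eq distrib_right free.scale_right_distrib)
qed simp

lemma scale_mult: "scale c f * g = scale c (f * g)"
  by (simp add: scale_def mult.assoc)

lemma free_alg_zero [simp]: "0 \<in> free_alg X"
  by (simp add: free_alg_def)

lemma free_alg_gen [simp]: "gen x \<in> free_alg X \<longleftrightarrow> x \<in> X"
  by (simp add: free_alg_def gen_def)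

lemma free_alg_single: "w \<noteq> [] \<Longrightarrow> set w \<subseteq> X \<Longrightarrow> Poly_Mapping.single w c \<in> free_alg X"
  by (simp add: free_alg_def)

lemma free_alg_add [simp]: "f \<in> free_alg X \<Longrightarrow> g \<in> free_alg X \<Longrightarrow> f + g \<in> free_alg X"
  using keys_add[of f g] unfolding free_alg_def by blast

lemma free_alg_mult [simp]: "f \<in> free_alg X \<Longrightarrow> g \<in> free_alg X \<Longrightarrow> f * g \<in> free_alg X"
  using keys_mult[of f g] unfolding free_alg_def plus_list_def by fastforce

lemma free_alg_scale [simp]: "f \<in> free_alg X \<Longrightarrow> scale c f \<in> free_alg X"
  using keys_mult[of "Poly_Mapping.single [] c" f]
  unfolding free_alg_def scale_def plus_list_def by (auto split: if_splits)

lemma subspace_free_alg: "free.subspace (free_alg X)"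
  by (simp add: free.subspace_def)

lemmas free_alg_diff [simp] = free.subspace_diff [OF subspace_free_alg]
lemmas free_alg_sum = free.subspace_sum [OF subspace_free_alg]

lemma subspace_alg_ideal: "free.subspace (alg_ideal X R)"
  by (simp add: free.subspace_def alg_ideal.intros)

lemmas alg_ideal_diff = free.subspace_diff [OF subspace_alg_ideal]
lemmas alg_ideal_sum = free.subspace_sum [OF subspace_alg_ideal]

lemma alg_ideal_subset:
  assumes "R \<subseteq> free_alg X"
  shows "alg_ideal X R \<subseteq> free_alg X"
proof
  fix f assume "f \<in> alg_ideal X R"
  then show "f \<in> free_alg X" by induction (use assms in auto)
qed

section \<open>Gradings and homogeneous ideals\<close>

definition word_degree :: "('g \<Rightarrow> int) \<Rightarrow> 'g list \<Rightarrow> int" where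
  "word_degree d w = sum_list (map d w)"

text \<open>The projection onto the homogeneous part of degree \<open>i\<close>.\<close>

definition component :: "('g \<Rightarrow> int) \<Rightarrow> int \<Rightarrow> ('g list \<Rightarrow>\<^sub>0 'k::field) \<Rightarrow> ('g list \<Rightarrow>\<^sub>0 'k)" where
  "component d i f = Poly_Mapping.mapp (\<lambda>w c. c when word_degree d w = i) f"

lemma lookup_component:
  "Poly_Mapping.lookup (component d i f) w = (Poly_Mapping.lookup f w when word_degree d w = i)"
  by (simp add: component_def lookup_mapp when_def in_keys_iff)

lemma component_zero [simp]: "component d i 0 = 0"
  by (intro poly_mapping_eqI) (simp add: lookup_component)

lemma component_add: "component d i (f + g) = component d i f + component d i g"
  by (intro poly_mapping_eqI) (simp add: lookup_component lookup_add when_def)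

lemma component_diff: "component d i (f - g) = component d i f - component d i g"
  by (intro poly_mapping_eqI) (simp add: lookup_component lookup_minus when_def)

lemma component_sum: "component d i (sum f A) = (\<Sum>a\<in>A. component d i (f a))"
  by (induction A rule: infinite_finite_induct) (simp_all add: component_add)

lemma component_single:
  "component d i (Poly_Mapping.single w c) = (if word_degree d w = i then Poly_Mapping.single w c else 0)"
  by (intro poly_mapping_eqI) (auto simp: lookup_component lookup_single when_def)

lemma component_single_mult:
  "component d i (Poly_Mapping.single w c * f) = Poly_Mapping.single w c * component d (i - word_degree d w) f"
  and component_mult_single:
  "component d i (f * Poly_Mapping.single w c) = component d (i - word_degree d w) f * Poly_Mapping.single w c"
proof (induction f rule: update_induct)
  case (update f v b)
  have eq: "Poly_Mapping.update v b f = f + Poly_Mapping.single v b"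
    using update(1) by (rule update_eq_add_single)
  case 1
  show ?case
    by (simp add: eq update component_add distrib_left component_single word_degree_def algebra_simps)
  case 2
  show ?case
    by (simp add: eq update component_add distrib_right component_single word_degree_def algebra_simps)
qed simp_all

lemma component_scale: "component d i (scale c f) = scale c (component d i f)"
  by (simp add: scale_def component_single_mult word_degree_def)

text \<open>An ideal generated by homogeneous elements is graded. In the product cases the factor
  \<open>a\<close> is split into words; each word merely shifts degrees, so the induction hypothesis
  is applied in a shifted degree and \<open>i\<close> must stay arbitrary.\<close>

lemma alg_ideal_component:
  assumes hom: "\<And>r. r \<in> R \<Longrightarrow> \<exists>i. component d i r = r"
    and f: "f \<in> alg_ideal X R"
  shows "component d i f \<in> alg_ideal X R"
  using f
proof (induction arbitrary: i)
  case zero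
  then show ?case by (simp add: alg_ideal.zero)
next
  case (rel r)
  obtain j where j: "component d j r = r" using hom[OF rel] by blast
  have "Poly_Mapping.lookup r w = 0" if "word_degree d w \<noteq> j" for w
    using lookup_component[of d j r w] that by (simp add: j)
  then have "component d i r = (if i = j then r else 0)"
    by (auto intro!: poly_mapping_eqI simp: lookup_component when_def)
  then show ?case using rel by (simp add: alg_ideal.zero alg_ideal.rel)
next
  case (add f g)
  then show ?case by (simp add: component_add alg_ideal.add)
next
  case (smult f c)
  then show ?case by (simp add: component_scale alg_ideal.smult)
next
  case (lmult a f)
  from lmult(1) show ?case
  proof (induction rule: free_alg_induct)
    case (add a w c)
    then show ?case
      using lmult.IH
      by (auto simp: distrib_right component_add component_single_mult
          intro!: alg_ideal.add alg_ideal.lmult free_alg_single)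
  qed (simp add: alg_ideal.zero)
next
  case (rmult f a)
  from rmult(2) show ?case
  proof (induction rule: free_alg_induct)
    case (add a w c)
    then show ?case
      using rmult.IH
      by (auto simp: distrib_left component_add component_mult_single
          intro!: alg_ideal.add alg_ideal.rmult free_alg_single)
  qed (simp add: alg_ideal.zero)
qed

fun lpa_degree :: "('v, 'e) lpa_gen \<Rightarrow> int" where
  "lpa_degree (Vertex v) = 0"
| "lpa_degree (Edge e) = 1"
| "lpa_degree (Ghost e) = -1"

lemma lpa_rels_homogeneous:
  assumes "r \<in> lpa_rels E"
  shows "\<exists>i. component lpa_degree i r = r"
proof -
  have "component lpa_degree 0 r = r \<or> component lpa_degree 1 r = r \<or> component lpa_degree (- 1) r = r"
    using assms unfolding lpa_rels_def
    by (auto simp: gen_mult_gen component_diff component_sum)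
      (auto simp: gen_def component_single word_degree_def)
  then show ?thesis by blast
qed

section \<open>From the quotient algebra to a matrix representation\<close>

lemma lpa_gens_simps [simp]:
  "Vertex v \<in> lpa_gens E \<longleftrightarrow> v \<in> verts E"
  "Edge e \<in> lpa_gens E \<longleftrightarrow> e \<in> arcs E"
  "Ghost e \<in> lpa_gens E \<longleftrightarrow> e \<in> arcs E"
  by (auto simp: lpa_gens_def)

lemma (in wf_digraph) lpa_rels_subset: "lpa_rels G \<subseteq> free_alg (lpa_gens G)"
  unfolding lpa_rels_def by (auto intro!: free_alg_diff free_alg_sum)

lemma equiv_lpa_cong: "equiv (free_alg (lpa_gens E)) (lpa_cong E)"
proof (rule equivI)
  show "lpa_cong E \<subseteq> free_alg (lpa_gens E) \<times> free_alg (lpa_gens E)"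
    by (auto simp: lpa_cong_def)
  show "refl_on (free_alg (lpa_gens E)) (lpa_cong E)"
    by (auto simp: refl_on_def lpa_cong_def alg_ideal.zero)
  show "sym (lpa_cong E)"
  proof (rule symI)
    fix f g assume "(f, g) \<in> lpa_cong E"
    then show "(g, f) \<in> lpa_cong E"
      using alg_ideal_diff[OF alg_ideal.zero, of "f - g" "lpa_gens E" "lpa_rels E"]
      by (simp add: lpa_cong_def)
  qed
  show "trans (lpa_cong E)"
  proof (rule transI)
    fix f g h assume "(f, g) \<in> lpa_cong E" "(g, h) \<in> lpa_cong E"
    then show "(f, h) \<in> lpa_cong E"
      using alg_ideal.add[of "f - g" "lpa_gens E" "lpa_rels E" "g - h"]
      by (simp add: lpa_cong_def)
  qed
qed

text \<open>The operations of \<open>leavitt\<close> are unions over representatives; since the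
  ideal is respected by sums, products and scalars, each union collapses to a single class.\<close>

lemma leavitt_ops:
  fixes f g :: "('v, 'e) lpa_gen list \<Rightarrow>\<^sub>0 'k::field"
  assumes "f \<in> free_alg (lpa_gens E)" and "g \<in> free_alg (lpa_gens E)"
  shows "lpa_cong E `` {f} \<in> carrier (leavitt E)"
    and "lpa_cong E `` {f} \<oplus>\<^bsub>leavitt E\<^esub> lpa_cong E `` {g} = lpa_cong E `` {f + g}"
    and "lpa_cong E `` {f} \<otimes>\<^bsub>leavitt E\<^esub> lpa_cong E `` {g} = lpa_cong E `` {f * g}"
    and "c \<odot>\<^bsub>leavitt E\<^esub> lpa_cong E `` {f} = lpa_cong E `` {scale c f}"
proof -
  let ?A = "free_alg (lpa_gens E)" and ?I = "alg_ideal (lpa_gens E) (lpa_rels E)"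
  let ?R = "lpa_cong E :: (('v, 'e) lpa_gen list \<Rightarrow>\<^sub>0 'k) rel"
  note class_eq = equiv_class_eq[OF equiv_lpa_cong]
  show "lpa_cong E `` {f} \<in> carrier (leavitt E)"
    using assms(1) by (simp add: leavitt_def quotientI)
  have "congruent2 ?R ?R (\<lambda>a b. lpa_cong E `` {a + b})"
  proof (intro congruent2I')
    fix a a' b b' assume "(a, a') \<in> ?R" "(b, b') \<in> ?R"
    then show "lpa_cong E `` {a + b} = lpa_cong E `` {a' + b'}"
      using alg_ideal.add[of "a - a'" "lpa_gens E" "lpa_rels E" "b - b'"]
      by (intro class_eq) (simp add: lpa_cong_def algebra_simps)
  qed
  from UN_equiv_class2[OF equiv_lpa_cong equiv_lpa_cong this assms]
  show "lpa_cong E `` {f} \<oplus>\<^bsub>leavitt E\<^esub> lpa_cong E `` {g} = lpa_cong E `` {f + g}"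
    by (simp add: leavitt_def)
  have "congruent2 ?R ?R (\<lambda>a b. lpa_cong E `` {a * b})"
  proof (intro congruent2I')
    fix a a' b b' assume *: "(a, a') \<in> ?R" "(b, b') \<in> ?R"
    have "a * b - a' * b' = (a - a') * b + a' * (b - b')" by (simp add: algebra_simps)
    also have "\<dots> \<in> ?I"
      using * by (intro alg_ideal.add alg_ideal.rmult alg_ideal.lmult) (auto simp: lpa_cong_def)
    finally show "lpa_cong E `` {a * b} = lpa_cong E `` {a' * b'}"
      using * by (intro class_eq) (simp add: lpa_cong_def)
  qed
  from UN_equiv_class2[OF equiv_lpa_cong equiv_lpa_cong this assms]
  show "lpa_cong E `` {f} \<otimes>\<^bsub>leavitt E\<^esub> lpa_cong E `` {g} = lpa_cong E `` {f * g}"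
    by (simp add: leavitt_def)
  have "congruent ?R (\<lambda>a. lpa_cong E `` {scale c a})"
  proof (rule congruentI)
    fix a a' assume "(a, a') \<in> ?R"
    then show "lpa_cong E `` {scale c a} = lpa_cong E `` {scale c a'}"
      using alg_ideal.smult[of "a - a'" "lpa_gens E" "lpa_rels E" c]
      by (intro class_eq) (simp add: lpa_cong_def free.scale_right_diff_distrib)
  qed
  from UN_equiv_class[OF equiv_lpa_cong this assms(1)]
  show "c \<odot>\<^bsub>leavitt E\<^esub> lpa_cong E `` {f} = lpa_cong E `` {scale c f}"
    by (simp add: leavitt_def)
qed

text \<open>Composing the isomorphism with the quotient map gives a surjective algebra homomorphism
  from the free algebra onto the matrices, with the ideal as kernel. All later arguments use
  elements instead of cosets.\<close>

locale leavitt_matrix = fin_digraph E for E :: "('v, 'e) pre_digraph" +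
  fixes n :: nat and \<Phi> :: "(('v, 'e) lpa_gen list \<Rightarrow>\<^sub>0 'k::field) \<Rightarrow> 'k mat"
  assumes rep_carrier: "f \<in> free_alg (lpa_gens E) \<Longrightarrow> \<Phi> f \<in> carrier_mat n n"
    and rep_add: "f \<in> free_alg (lpa_gens E) \<Longrightarrow> g \<in> free_alg (lpa_gens E) \<Longrightarrow> \<Phi> (f + g) = \<Phi> f + \<Phi> g"
    and rep_mult: "f \<in> free_alg (lpa_gens E) \<Longrightarrow> g \<in> free_alg (lpa_gens E) \<Longrightarrow> \<Phi> (f * g) = \<Phi> f * \<Phi> g"
    and rep_scale: "f \<in> free_alg (lpa_gens E) \<Longrightarrow> \<Phi> (scale c f) = c \<cdot>\<^sub>m \<Phi> f"
    and rep_surj: "M \<in> carrier_mat n n \<Longrightarrow> \<exists>f \<in> free_alg (lpa_gens E). \<Phi> f = M"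
    and rep_eq_zero_iff: "f \<in> free_alg (lpa_gens E) \<Longrightarrow>
      \<Phi> f = 0\<^sub>m n n \<longleftrightarrow> f \<in> alg_ideal (lpa_gens E) (lpa_rels E)"

lemma leavitt_matrixI:
  fixes E :: "('v, 'e) pre_digraph"
  assumes "fin_digraph E"
    and "alg_iso (leavitt E :: ('k::field, (('v, 'e) lpa_gen list \<Rightarrow>\<^sub>0 'k) set) module)
                 (module_mat TYPE('k) n n)"
  obtains \<Phi> :: "(('v, 'e) lpa_gen list \<Rightarrow>\<^sub>0 'k::field) \<Rightarrow> 'k mat" where "leavitt_matrix E n \<Phi>"
proof -
  let ?A = "free_alg (lpa_gens E) :: (('v, 'e) lpa_gen list \<Rightarrow>\<^sub>0 'k) set"
  let ?L = "leavitt E :: ('k::field, (('v, 'e) lpa_gen list \<Rightarrow>\<^sub>0 'k) set) module"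
  let ?M = "module_mat TYPE('k) n n"
  let ?c = "\<lambda>f. lpa_cong E `` {f}"
  obtain h where h: "h \<in> ring_iso ?L ?M"
    and hs: "\<And>c x. x \<in> carrier ?L \<Longrightarrow> h (c \<odot>\<^bsub>?L\<^esub> x) = c \<cdot>\<^sub>m h x"
    using assms(2) by (auto simp: alg_iso_def module_mat_simps)
  have hom: "h \<in> ring_hom ?L ?M" and bij: "bij_betw h (carrier ?L) (carrier_mat n n)"
    using h by (auto simp: ring_iso_def module_mat_simps)
  define \<Phi> where "\<Phi> f = h (?c f)" for f
  note c = leavitt_ops(1)
  have carr: "\<Phi> f \<in> carrier_mat n n" if "f \<in> ?A" for f
    using bij c[OF that that] by (auto simp: \<Phi>_def bij_betw_def)
  have add: "\<Phi> (f + g) = \<Phi> f + \<Phi> g" if "f \<in> ?A" "g \<in> ?A" for f g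
    using ring_hom_add[OF hom c[OF that] c[OF that(2,1)]] leavitt_ops(2)[OF that]
    by (simp add: \<Phi>_def module_mat_simps)
  have mult: "\<Phi> (f * g) = \<Phi> f * \<Phi> g" if "f \<in> ?A" "g \<in> ?A" for f g
    using ring_hom_mult[OF hom c[OF that] c[OF that(2,1)]] leavitt_ops(3)[OF that]
    by (simp add: \<Phi>_def module_mat_simps)
  have scale: "\<Phi> (scale c f) = c \<cdot>\<^sub>m \<Phi> f" if "f \<in> ?A" for c f
    using hs[OF c[OF that that]] leavitt_ops(4)[OF that that] by (simp add: \<Phi>_def)
  have surj: "\<exists>f \<in> ?A. \<Phi> f = M" if "M \<in> carrier_mat n n" for M
  proof -
    have "M \<in> h ` carrier ?L" using that bij by (simp add: bij_betw_def)
    then obtain x where "x \<in> carrier ?L" "h x = M" by blast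
    then show ?thesis by (auto simp: leavitt_def \<Phi>_def elim!: quotientE)
  qed
  have zero: "\<Phi> 0 = 0\<^sub>m n n"
  proof -
    have "\<Phi> 0 = 0 \<cdot>\<^sub>m \<Phi> 0" using scale[of 0 0] by simp
    also have "\<dots> = 0\<^sub>m n n" using carr[of 0] by (intro eq_matI) auto
    finally show ?thesis .
  qed
  have "\<Phi> f = 0\<^sub>m n n \<longleftrightarrow> f \<in> alg_ideal (lpa_gens E) (lpa_rels E)" if "f \<in> ?A" for f
  proof -
    have "\<Phi> f = 0\<^sub>m n n \<longleftrightarrow> ?c f = ?c 0"
      using bij c[OF that that] c[of 0 E 0] unfolding zero[symmetric] \<Phi>_def
      by (auto simp: bij_betw_def dest: inj_onD)
    also have "\<dots> \<longleftrightarrow> (f, 0) \<in> lpa_cong E"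
      using eq_equiv_class_iff[OF equiv_lpa_cong that] by simp
    also have "\<dots> \<longleftrightarrow> f \<in> alg_ideal (lpa_gens E) (lpa_rels E)"
      using that by (simp add: lpa_cong_def)
    finally show ?thesis .
  qed
  with assms(1) carr add mult scale surj have "leavitt_matrix E n \<Phi>"
    by (simp add: leavitt_matrix_def leavitt_matrix_axioms_def)
  then show thesis by (rule that)
qed

section \<open>Leavitt path algebras isomorphic to matrix algebras\<close>

lemma nonzero_mat_entry:
  assumes "M \<in> carrier_mat n n" and "M \<noteq> 0\<^sub>m n n"
  obtains i j where "i < n" "j < n" "M $$ (i, j) \<noteq> 0"
  using assms by (metis carrier_matD eq_matI index_zero_mat)

text \<open>Matrix rings are prime: for nonzero entries \<open>M $$ (i, j)\<close> and
  \<open>N $$ (k, l)\<close>, the matrix unit at \<open>(j, k)\<close> put in between makes the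
  entry at \<open>(i, l)\<close> their product.\<close>

lemma mat_sandwich_nonzero:
  fixes M N :: "'k::field mat"
  assumes M: "M \<in> carrier_mat n n" "M \<noteq> 0\<^sub>m n n" and N: "N \<in> carrier_mat n n" "N \<noteq> 0\<^sub>m n n"
  obtains Q where "Q \<in> carrier_mat n n" and "M * Q * N \<noteq> 0\<^sub>m n n"
proof -
  obtain i j where ij: "i < n" "j < n" "M $$ (i, j) \<noteq> 0" using M by (rule nonzero_mat_entry)
  obtain k l where kl: "k < n" "l < n" "N $$ (k, l) \<noteq> 0" using N by (rule nonzero_mat_entry)
  define Q :: "'k mat" where "Q = mat n n (\<lambda>(a, b). if a = j \<and> b = k then 1 else 0)"
  have Q: "Q \<in> carrier_mat n n" by (simp add: Q_def)
  have MQ: "(M * Q) $$ (i, c) = (if c = k then M $$ (i, j) else 0)" if "c < n" for c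
  proof -
    have "(M * Q) $$ (i, c) = (\<Sum>a = 0..<n. M $$ (i, a) * (if a = j \<and> c = k then 1 else 0))"
      using M(1) ij that by (simp add: scalar_prod_def Q_def)
    also have "\<dots> = (\<Sum>a = 0..<n. if a = j then (if c = k then M $$ (i, j) else 0) else 0)"
      by (intro sum.cong) auto
    finally show ?thesis using ij by simp
  qed
  have "(M * Q * N) $$ (i, l) = (\<Sum>c = 0..<n. (M * Q) $$ (i, c) * N $$ (c, l))"
    using M(1) N(1) Q ij kl by (simp add: scalar_prod_def del: assoc_mult_mat)
  also have "\<dots> = (\<Sum>c = 0..<n. if c = k then M $$ (i, j) * N $$ (k, l) else 0)"
    using MQ by (intro sum.cong) auto
  also have "\<dots> = M $$ (i, j) * N $$ (k, l)" using kl by simp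
  finally have "M * Q * N \<noteq> 0\<^sub>m n n" using ij kl by auto
  with Q show thesis by (rule that)
qed

text \<open>Two-sided multiplication is linear, so the preimage of a span is a subspace and testing
  on \<open>S\<close> suffices.\<close>

lemma span_mult_closed:
  assumes "f \<in> free.span S" and "\<And>b. b \<in> S \<Longrightarrow> a * b * c \<in> free.span T"
  shows "a * f * c \<in> free.span T"
proof -
  have "free.subspace {f. a * f * c \<in> free.span T}"
    by (auto simp: free.subspace_def free.span_zero distrib_left distrib_right free.span_add
        mult_scale scale_mult free.span_scale)
  from free.span_induct[OF assms(1) this] assms(2) show ?thesis by simp
qed

section \<open>Calculation modulo the ideal\<close>

context leavitt_matrix
begin

abbreviation A :: "(('v, 'e) lpa_gen list \<Rightarrow>\<^sub>0 'k) set" where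
  "A \<equiv> free_alg (lpa_gens E)"

abbreviation I :: "(('v, 'e) lpa_gen list \<Rightarrow>\<^sub>0 'k) set" where
  "I \<equiv> alg_ideal (lpa_gens E) (lpa_rels E)"

text \<open>Unlike \<open>lpa_cong\<close>, this relation carries no membership conditions, which
  keeps chains of congruences short.\<close>

definition eqv :: "(('v, 'e) lpa_gen list \<Rightarrow>\<^sub>0 'k) \<Rightarrow> (('v, 'e) lpa_gen list \<Rightarrow>\<^sub>0 'k) \<Rightarrow> bool"
    (infix \<open>\<approx>\<close> 50) where
  "f \<approx> g \<longleftrightarrow> f - g \<in> I"

lemma I_subset_A: "I \<subseteq> A"
  by (rule alg_ideal_subset[OF lpa_rels_subset])

lemma eqv_refl [simp]: "f \<approx> f"
  by (simp add: eqv_def alg_ideal.zero)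

lemma eqv_zero_iff: "f \<approx> 0 \<longleftrightarrow> f \<in> I"
  by (simp add: eqv_def)

lemma eqv_sym: "f \<approx> g \<Longrightarrow> g \<approx> f"
  using alg_ideal_diff[OF alg_ideal.zero, of "f - g"] by (simp add: eqv_def)

lemma eqv_trans [trans]: "f \<approx> g \<Longrightarrow> g \<approx> h \<Longrightarrow> f \<approx> h"
  using alg_ideal.add[of "f - g" _ _ "g - h"] by (simp add: eqv_def)

lemma eqv_mult_left: "f \<approx> g \<Longrightarrow> a \<in> A \<Longrightarrow> a * f \<approx> a * g"
  using alg_ideal.lmult[of a _ "f - g"] by (simp add: eqv_def right_diff_distrib)

lemma eqv_mult_right: "f \<approx> g \<Longrightarrow> a \<in> A \<Longrightarrow> f * a \<approx> g * a"
  using alg_ideal.rmult[of "f - g" _ _ a] by (simp add: eqv_def left_diff_distrib)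

lemma I_sandwich: "f \<in> I \<Longrightarrow> a \<in> A \<Longrightarrow> b \<in> A \<Longrightarrow> a * f * b \<in> I"
  by (simp add: alg_ideal.lmult alg_ideal.rmult)

lemma eqv_mem_I: "f \<approx> g \<Longrightarrow> g \<in> I \<Longrightarrow> f \<in> I"
  using eqv_trans eqv_zero_iff by blast

lemma lpa_relations:
  shows vx_vx: "v \<in> verts E \<Longrightarrow> w \<in> verts E \<Longrightarrow> vx v * vx w \<approx> (if v = w then vx v else 0)"
    and vx_tail_ed: "e \<in> arcs E \<Longrightarrow> vx (tail E e) * ed e \<approx> ed e"
    and ed_vx_head: "e \<in> arcs E \<Longrightarrow> ed e * vx (head E e) \<approx> ed e"
    and vx_head_gh: "e \<in> arcs E \<Longrightarrow> vx (head E e) * gh e \<approx> gh e"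
    and gh_vx_tail: "e \<in> arcs E \<Longrightarrow> gh e * vx (tail E e) \<approx> gh e"
    and gh_ed: "e \<in> arcs E \<Longrightarrow> f \<in> arcs E \<Longrightarrow> gh e * ed f \<approx> (if e = f then vx (head E e) else 0)"
    and vx_sum: "v \<in> verts E \<Longrightarrow> v \<notin> sinks E \<Longrightarrow> vx v \<approx> (\<Sum>e \<in> out_arcs E v. ed e * gh e)"
  unfolding eqv_def by (rule alg_ideal.rel; unfold lpa_rels_def; blast)+

text \<open>The tail vertex is inserted in front of the edge, and orthogonality of the vertices
  decides.\<close>

lemma vx_ed:
  assumes "v \<in> verts E" and "e \<in> arcs E"
  shows "vx v * ed e \<approx> (if v = tail E e then ed e else 0)"
proof -
  have "vx v * ed e \<approx> vx v * (vx (tail E e) * ed e)"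
    using assms by (intro eqv_mult_left eqv_sym[OF vx_tail_ed]) auto
  also have "\<dots> = vx v * vx (tail E e) * ed e" by (simp add: mult.assoc)
  also have "\<dots> \<approx> (if v = tail E e then vx v else 0) * ed e"
    using assms by (intro eqv_mult_right vx_vx) auto
  also have "\<dots> \<approx> (if v = tail E e then ed e else 0)"
    using vx_tail_ed assms by auto
  finally show ?thesis .
qed

lemma gh_vx:
  assumes "v \<in> verts E" and "e \<in> arcs E"
  shows "gh e * vx v \<approx> (if v = tail E e then gh e else 0)"
proof -
  have "gh e * vx v \<approx> (gh e * vx (tail E e)) * vx v"
    using assms by (intro eqv_mult_right eqv_sym[OF gh_vx_tail]) auto
  also have "\<dots> = gh e * (vx (tail E e) * vx v)" by (simp add: mult.assoc)
  also have "\<dots> \<approx> gh e * (if tail E e = v then vx (tail E e) else 0)"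
    using assms by (intro eqv_mult_left vx_vx) auto
  also have "\<dots> \<approx> (if v = tail E e then gh e else 0)"
    using gh_vx_tail assms by auto
  finally show ?thesis .
qed

section \<open>The subgraph of nonzero vertices\<close>

text \<open>In fact no vertex lies in the ideal and \<open>F = E\<close>, but restricting to \<open>F\<close> avoids the proof.\<close>

definition F :: "('v, 'e) pre_digraph" where
  "F = E\<lparr>verts := {v \<in> verts E. vx v \<notin> I}, arcs := {e \<in> arcs E. vx (head E e) \<notin> I}\<rparr>"

lemma F_simps [simp]:
  "v \<in> verts F \<longleftrightarrow> v \<in> verts E \<and> vx v \<notin> I"
  "e \<in> arcs F \<longleftrightarrow> e \<in> arcs E \<and> vx (head E e) \<notin> I"
  "tail F = tail E" "head F = head E"
  by (simp_all add: F_def)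

text \<open>Both generators of an arc absorb its head vertex, so they vanish in the quotient along
  with it.\<close>

lemma dead_arc:
  assumes "e \<in> arcs E" and "vx (head E e) \<in> I"
  shows "ed e \<in> I" and "gh e \<in> I"
proof -
  have "ed e * vx (head E e) \<in> I" using assms by (intro alg_ideal.lmult) auto
  then show "ed e \<in> I" using eqv_mem_I eqv_sym ed_vx_head assms(1) by blast
  have "vx (head E e) * gh e \<in> I" using assms by (intro alg_ideal.rmult) auto
  then show "gh e \<in> I" using eqv_mem_I eqv_sym vx_head_gh assms(1) by blast
qed

text \<open>\<open>F\<close> selects arcs by their heads only, so the tails need an argument: if the
  tail vertex is in the ideal, then so is \<open>ed e\<close>, hence also
  \<open>gh e * ed e\<close>, which is congruent to the head vertex.\<close>

lemma fin_digraph_F: "fin_digraph F"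
proof
  fix e assume e: "e \<in> arcs F"
  show "tail F e \<in> verts F"
  proof (rule ccontr)
    assume "tail F e \<notin> verts F"
    then have "vx (tail E e) * ed e \<in> I" using e by (auto intro: alg_ideal.rmult)
    then have "ed e \<in> I" using eqv_mem_I[OF eqv_sym[OF vx_tail_ed]] e by simp
    then have "gh e * ed e \<in> I" using e by (auto intro: alg_ideal.lmult)
    then have "vx (head E e) \<in> I" using eqv_mem_I[OF eqv_sym[OF gh_ed[of e e]]] e by simp
    with e show False by simp
  qed
qed (auto simp: F_def)

interpretation F: fin_digraph F
  by (rule fin_digraph_F)

text \<open>No new sinks appear: if all arcs leaving a non-sink \<open>v\<close> of \<open>E\<close>
  were lost, every summand \<open>ed e * gh e\<close> of \<open>vx v\<close> would be in the ideal,
  and so would \<open>vx v\<close>.\<close>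

lemma sinks_F: "v \<in> sinks F \<longleftrightarrow> v \<in> verts F \<and> v \<in> sinks E"
proof
  assume v: "v \<in> sinks F"
  then have vF: "v \<in> verts F" by (simp add: sinks_def)
  have "v \<in> sinks E"
  proof (rule ccontr)
    assume nv: "v \<notin> sinks E"
    have "ed e * gh e \<in> I" if "e \<in> out_arcs E v" for e
    proof -
      have "e \<in> arcs E" "tail E e = v" using that by auto
      then have "e \<notin> arcs F" using v by (auto simp: sinks_def out_arcs_def)
      with \<open>e \<in> arcs E\<close> show ?thesis by (auto intro!: alg_ideal.lmult dead_arc)
    qed
    then have "(\<Sum>e \<in> out_arcs E v. ed e * gh e) \<in> I" by (rule alg_ideal_sum)
    then show False using eqv_mem_I[OF vx_sum] vF nv F_simps(1) by blast
  qed
  with vF show "v \<in> verts F \<and> v \<in> sinks E" by blast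
qed (auto simp: sinks_def out_arcs_def)

section \<open>Monomials of paths\<close>

text \<open>The final vertex is kept as a letter, so that the trivial path also gives a nonempty
  word, as \<open>free_alg\<close> requires. \<open>bwd\<close> is the mirror image in ghost
  edges.\<close>

primrec fwd :: "'v \<Rightarrow> 'e list \<Rightarrow> (('v, 'e) lpa_gen list \<Rightarrow>\<^sub>0 'k)" where
  "fwd w [] = vx w"
| "fwd w (e # p) = ed e * fwd w p"

primrec bwd :: "'v \<Rightarrow> 'e list \<Rightarrow> (('v, 'e) lpa_gen list \<Rightarrow>\<^sub>0 'k)" where
  "bwd w [] = vx w"
| "bwd w (e # p) = bwd w p * gh e"

lemma fwd_eq_single: "fwd w p = Poly_Mapping.single (map Edge p @ [Vertex w]) 1"
  by (induction p) (simp_all add: gen_def)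

lemma path_in_A: "F.awalk u p w \<Longrightarrow> fwd w p \<in> A \<and> bwd w p \<in> A"
  by (induction p arbitrary: u) (auto simp: F.awalk_simps)

lemmas fwd_in_A = path_in_A[THEN conjunct1]
lemmas bwd_in_A = path_in_A[THEN conjunct2]

lemma vx_fwd:
  assumes "F.awalk u p w" and "v \<in> verts E"
  shows "vx v * fwd w p \<approx> (if v = u then fwd w p else 0)"
proof (cases p)
  case Nil
  then show ?thesis using assms vx_vx[of v w] by (auto simp: F.awalk_simps)
next
  case (Cons e q)
  then have e: "e \<in> arcs E" "tail E e = u" and q: "F.awalk (head E e) q w"
    using assms by (auto simp: F.awalk_simps)
  have "vx v * ed e * fwd w q \<approx> (if v = u then ed e else 0) * fwd w q"
    using vx_ed[OF assms(2) e(1)] fwd_in_A[OF q] unfolding e(2) by (rule eqv_mult_right)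
  then show ?thesis using Cons by (auto simp: mult.assoc)
qed

lemma bwd_vx:
  assumes "F.awalk u p w" and "v \<in> verts E"
  shows "bwd w p * vx v \<approx> (if v = u then bwd w p else 0)"
proof (cases p)
  case Nil
  then show ?thesis using assms vx_vx[of w v] by (auto simp: F.awalk_simps)
next
  case (Cons e q)
  then have e: "e \<in> arcs E" "tail E e = u" and q: "F.awalk (head E e) q w"
    using assms by (auto simp: F.awalk_simps)
  have "bwd w q * (gh e * vx v) \<approx> bwd w q * (if v = u then gh e else 0)"
    using gh_vx[OF assms(2) e(1)] bwd_in_A[OF q] unfolding e(2) by (rule eqv_mult_left)
  then show ?thesis using Cons by (auto simp: mult.assoc)
qed

lemma ed_fwd_zero:
  assumes "F.awalk u p w" and "e \<in> arcs E" and "head E e \<noteq> u"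
  shows "ed e * fwd w p \<in> I"
proof -
  have "ed e * fwd w p \<approx> ed e * vx (head E e) * fwd w p"
    using assms by (intro eqv_mult_right eqv_sym[OF ed_vx_head] fwd_in_A)
  also have "\<dots> = ed e * (vx (head E e) * fwd w p)" by (simp add: mult.assoc)
  also have "\<dots> \<approx> ed e * 0"
    using vx_fwd[OF assms(1), of "head E e"] assms by (intro eqv_mult_left) auto
  finally show ?thesis by (simp add: eqv_zero_iff)
qed

lemma gh_fwd_Cons:
  assumes "F.awalk u (f # p) w" and "e \<in> arcs E"
  shows "gh e * fwd w (f # p) \<approx> (if e = f then fwd w p else 0)"
proof -
  have f: "f \<in> arcs E" and p: "F.awalk (head E f) p w" using assms by (auto simp: F.awalk_simps)
  have "gh e * ed f * fwd w p \<approx> (if e = f then vx (head E e) else 0) * fwd w p"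
    using gh_ed[OF assms(2) f] fwd_in_A[OF p] by (rule eqv_mult_right)
  also have "\<dots> \<approx> (if e = f then fwd w p else 0)"
    using vx_fwd[OF p, of "head E f"] f by auto
  finally show ?thesis by (simp add: mult.assoc)
qed

text \<open>A sink of \<open>F\<close> is a sink of \<open>E\<close>, so it is not the tail of any
  arc, even one outside \<open>F\<close>.\<close>

lemma gh_vx_sink:
  assumes "w \<in> sinks F" and "e \<in> arcs E"
  shows "gh e * vx w \<in> I"
proof -
  have w: "w \<in> sinks E" using assms(1) sinks_F by blast
  then have "tail E e \<noteq> w" using assms(2) by (auto simp: sinks_def)
  then show ?thesis using gh_vx[of w e] w assms(2) by (auto simp: sinks_def eqv_zero_iff)
qed

text \<open>The adjacent pairs of a ghost edge and its edge collapse from the inside out. This shows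
  that path monomials of \<open>F\<close> are nonzero in the quotient.\<close>

lemma bwd_fwd:
  assumes "F.awalk u p w"
  shows "bwd w p * fwd w p \<approx> vx w"
  using assms
proof (induction p arbitrary: u)
  case Nil
  then show ?case using vx_vx[of w w] by (auto simp: F.awalk_simps)
next
  case (Cons e p)
  then have e: "e \<in> arcs E" and p: "F.awalk (head E e) p w" by (auto simp: F.awalk_simps)
  have "bwd w p * (gh e * fwd w (e # p)) \<approx> bwd w p * fwd w p"
    using gh_fwd_Cons[OF Cons.prems e] bwd_in_A[OF p] by (auto intro: eqv_mult_left)
  also have "\<dots> \<approx> vx w" using p by (rule Cons.IH)
  finally show ?case by (simp add: mult.assoc)
qed

section \<open>Finitely many degrees and acyclicity\<close>

lemma rep_zero: "\<Phi> 0 = 0\<^sub>m n n"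
  by (simp add: rep_eq_zero_iff alg_ideal.zero)

lemma rep_sum_entry:
  assumes "\<And>s. s \<in> S \<Longrightarrow> f s \<in> A" and "i < n" and "j < n"
  shows "\<Phi> (\<Sum>s\<in>S. f s) $$ (i, j) = (\<Sum>s\<in>S. \<Phi> (f s) $$ (i, j))"
  using assms(1)
proof (induction S rule: infinite_finite_induct)
  case (insert s S)
  then have "(\<Sum>s\<in>S. f s) \<in> A" by (intro free_alg_sum) auto
  with insert show ?case
    using assms(2,3) rep_carrier[of "\<Sum>s\<in>S. f s"] by (simp add: rep_add)
qed (simp_all add: rep_zero assms)

lemma rep_eq_imp_eqv:
  assumes "f \<in> A" and "g \<in> A" and "\<Phi> f = \<Phi> g"
  shows "f \<approx> g"
proof -
  have fg: "f - g \<in> A" using assms by simp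
  have "\<Phi> f = \<Phi> (f - g) + \<Phi> g" using rep_add[OF fg assms(2)] by simp
  then have *: "\<Phi> g = \<Phi> (f - g) + \<Phi> g" using assms(3) by simp
  have "\<Phi> (f - g) $$ (i, j) = 0" if "i < n" "j < n" for i j
    using arg_cong[OF *, of "\<lambda>M. M $$ (i, j)"] that rep_carrier[OF fg] rep_carrier[OF assms(2)]
    by simp
  then have "\<Phi> (f - g) = 0\<^sub>m n n" using rep_carrier[OF fg] by (intro eq_matI) auto
  then show ?thesis using fg by (simp add: eqv_def rep_eq_zero_iff)
qed

text \<open>Preimages of the matrix units involve only finitely many degrees, and span modulo the
  homogeneous ideal; a word of any other degree therefore lies in the ideal.\<close>

lemma finite_degrees:
  "finite {word_degree lpa_degree w | w. w \<noteq> [] \<and> set w \<subseteq> lpa_gens E \<and> Poly_Mapping.single w 1 \<notin> I}"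
proof -
  have "\<forall>i j. \<exists>f \<in> A. \<Phi> f = mat n n (\<lambda>p. if p = (i, j) then 1 else 0)"
    using rep_surj by simp
  then obtain f where fA: "\<And>i j. f i j \<in> A"
    and f: "\<And>i j. \<Phi> (f i j) = mat n n (\<lambda>p. if p = (i, j) then 1 else 0)"
    by metis
  define D where "D = (\<Union>(i, j) \<in> {..<n} \<times> {..<n}. word_degree lpa_degree ` Poly_Mapping.keys (f i j))"
  have "Poly_Mapping.single w 1 \<in> I"
    if w: "w \<noteq> []" "set w \<subseteq> lpa_gens E" and wD: "word_degree lpa_degree w \<notin> D" for w
  proof -
    define s :: "('v, 'e) lpa_gen list \<Rightarrow>\<^sub>0 'k" where "s = Poly_Mapping.single w 1"
    have sA: "s \<in> A" unfolding s_def using w by (rule free_alg_single)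
    \<comment> \<open>The expansion of \<open>\<Phi> s\<close> in matrix units, lifted to the chosen
      preimages, so that \<open>\<Phi> g = \<Phi> s\<close>.\<close>
    define g where "g = (\<Sum>(i, j) \<in> {..<n} \<times> {..<n}. scale (\<Phi> s $$ (i, j)) (f i j))"
    have gA: "g \<in> A" unfolding g_def using fA by (intro free_alg_sum) auto
    have "\<Phi> g $$ (a, b) = \<Phi> s $$ (a, b)" if ab: "a < n" "b < n" for a b
    proof -
      have "\<Phi> g $$ (a, b) = (\<Sum>p \<in> {..<n} \<times> {..<n}. \<Phi> (case p of (i, j) \<Rightarrow> scale (\<Phi> s $$ (i, j)) (f i j)) $$ (a, b))"
        unfolding g_def by (rule rep_sum_entry) (use fA ab in auto)
      also have "\<dots> = (\<Sum>p \<in> {..<n} \<times> {..<n}. if p = (a, b) then \<Phi> s $$ (a, b) else 0)"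
        using ab by (intro sum.cong) (auto simp: rep_scale fA f split: if_splits)
      also have "\<dots> = \<Phi> s $$ (a, b)" using ab by (subst sum.delta) auto
      finally show ?thesis .
    qed
    then have "\<Phi> s = \<Phi> g"
      using rep_carrier[OF sA] rep_carrier[OF gA] by (intro eq_matI) auto
    then have "s - g \<in> I" using rep_eq_imp_eqv[OF sA gA] by (simp add: eqv_def)
    then have "component lpa_degree (word_degree lpa_degree w) (s - g) \<in> I"
      by (intro alg_ideal_component lpa_rels_homogeneous)
    moreover have "component lpa_degree (word_degree lpa_degree w) (f i j) = 0" if "i < n" "j < n" for i j
    proof (intro poly_mapping_eqI)
      fix v
      have "word_degree lpa_degree v \<noteq> word_degree lpa_degree w" if "v \<in> Poly_Mapping.keys (f i j)"
      proof -
        have "word_degree lpa_degree v \<in> D"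
          unfolding D_def using that \<open>i < n\<close> \<open>j < n\<close> by (intro UN_I[of "(i, j)"]) auto
        then show ?thesis using wD by auto
      qed
      then show "Poly_Mapping.lookup (component lpa_degree (word_degree lpa_degree w) (f i j)) v = Poly_Mapping.lookup 0 v"
        by (auto simp: lookup_component when_def in_keys_iff)
    qed
    then have "component lpa_degree (word_degree lpa_degree w) g = 0"
      unfolding g_def component_sum by (intro sum.neutral) (auto simp: component_scale)
    ultimately show ?thesis by (simp add: component_diff s_def component_single)
  qed
  then have "{word_degree lpa_degree w | w. w \<noteq> [] \<and> set w \<subseteq> lpa_gens E \<and> Poly_Mapping.single w 1 \<notin> I} \<subseteq> D"
    by blast
  moreover have "finite D" by (auto simp: D_def)
  ultimately show ?thesis by (rule finite_subset)
qed

lemma acyclic_F: "acyclic_digraph F"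
  unfolding acyclic_digraph_def
proof clarify
  fix u p assume p: "p \<noteq> []" "F.awalk u p u"
  have walk: "F.awalk u (concat (replicate k p)) u" for k
  proof (induction k)
    case 0 then show ?case using p by (auto simp: F.awalk_Nil_iff)
  next
    case (Suc k) then show ?case using p by (auto intro: F.awalk_appendI)
  qed
  \<comment> \<open>The word of the cycle traversed \<open>k\<close> times. Its final vertex letter
    has degree 0, so the degree is \<open>k * length p\<close>.\<close>
  let ?w = "\<lambda>k. map Edge (concat (replicate k p)) @ [Vertex u]"
  have "Poly_Mapping.single (?w k) 1 \<notin> I" for k
  proof
    assume "Poly_Mapping.single (?w k) 1 \<in> I"
    then have "bwd u (concat (replicate k p)) * fwd u (concat (replicate k p)) \<in> I"
      using bwd_in_A[OF walk] unfolding fwd_eq_single by (intro alg_ideal.lmult)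
    then have "vx u \<in> I" using eqv_mem_I eqv_sym bwd_fwd[OF walk] by blast
    then show False using F.awalk_hd_in_verts[OF p(2)] by simp
  qed
  moreover have "set (?w k) \<subseteq> lpa_gens E" for k
    using walk[of k] by (force simp: F.awalk_def)
  moreover have "word_degree lpa_degree (?w k) = int (k * length p)" for k
  proof -
    have "sum_list (map lpa_degree (map Edge q :: ('v, 'e) lpa_gen list)) = int (length q)" for q :: "'e list"
      by (induction q) auto
    then show ?thesis
      by (simp add: word_degree_def length_concat sum_list_replicate del: map_map)
  qed
  ultimately have "range (\<lambda>k. int (k * length p)) \<subseteq>
      {word_degree lpa_degree w | w. w \<noteq> [] \<and> set w \<subseteq> lpa_gens E \<and> Poly_Mapping.single w 1 \<notin> I}"
    by (smt (verit) Nil_is_append_conv image_subset_iff list.distinct(1) mem_Collect_eq)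
  then have "finite (range (\<lambda>k. int (k * length p)))"
    using finite_degrees by (rule finite_subset)
  moreover have "inj (\<lambda>k. int (k * length p))" using p(1) by (auto simp: inj_def)
  ultimately show False using finite_imageD infinite_UNIV_nat by blast
qed

section \<open>Spanning by monomials through sinks\<close>

text \<open>Spanning of the quotient is expressed inside the free algebra by adding \<open>I\<close>
  to the spanning set; congruent elements are then interchangeable.\<close>

lemma span_eqv:
  assumes "f \<approx> g" and "g \<in> free.span (B \<union> I)"
  shows "f \<in> free.span (B \<union> I)"
proof -
  have "f - g \<in> free.span (B \<union> I)" using assms(1) by (auto simp: eqv_def intro: free.span_base)
  from free.span_add[OF this assms(2)] show ?thesis by simp
qed

definition sink_monomials :: "(('v, 'e) lpa_gen list \<Rightarrow>\<^sub>0 'k) set" where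
  "sink_monomials = {fwd w p * bwd w q | w p q u v. w \<in> sinks F \<and> F.awalk u p w \<and> F.awalk v q w}"

lemma sink_monomialsI:
  "w \<in> sinks F \<Longrightarrow> F.awalk u p w \<Longrightarrow> F.awalk v q w \<Longrightarrow> fwd w p * bwd w q \<in> sink_monomials"
  unfolding sink_monomials_def by blast

text \<open>Sink induction: each summand \<open>ed e * gh e\<close> is congruent to
  \<open>ed e * vx (head E e) * gh e\<close>, and the expansion of the head turns into one for
  \<open>v\<close> as \<open>e\<close> is prefixed to both paths. For this both paths must start at
  the vertex being expanded.\<close>

lemma vx_in_span_aux:
  assumes "v \<in> verts F"
  shows "vx v \<in> free.span ({fwd w p * bwd w q | w p q. w \<in> sinks F \<and> F.awalk v p w \<and> F.awalk v q w} \<union> I)"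
    (is "_ \<in> free.span (?B v \<union> I)")
  using acyclic_F assms
proof (induction rule: F.acyclic_sink_induct)
  case (sink v)
  then have v: "F.awalk v [] v" "v \<in> verts E" by (auto simp: sinks_def F.awalk_Nil_iff)
  then have "fwd v [] * bwd v [] \<in> ?B v" using sink by blast
  then have "vx v * vx v \<in> free.span (?B v \<union> I)" by (auto intro: free.span_base)
  then show ?case using span_eqv[OF eqv_sym[OF vx_vx[of v v]]] v by simp
next
  case (step v)
  have "ed e * gh e \<in> free.span (?B v \<union> I)" if e: "e \<in> out_arcs E v" for e
  proof (cases "e \<in> arcs F")
    case False
    with e show ?thesis by (auto intro!: free.span_base alg_ideal.lmult dead_arc)
  next
    case True
    then have "vx (head E e) \<in> free.span (?B (head E e) \<union> I)"
      using step.IH[of e] e by auto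
    then have "ed e * vx (head E e) * gh e \<in> free.span (?B v \<union> I)"
    proof (rule span_mult_closed)
      fix b assume "b \<in> ?B (head E e) \<union> I"
      then show "ed e * b * gh e \<in> free.span (?B v \<union> I)"
      proof
        assume "b \<in> I"
        then have "ed e * b * gh e \<in> I" using e by (intro I_sandwich) auto
        then show ?thesis by (auto intro: free.span_base)
      next
        assume "b \<in> ?B (head E e)"
        then obtain w p q where b: "b = fwd w p * bwd w q" and w: "w \<in> sinks F"
          and "F.awalk (head E e) p w" "F.awalk (head E e) q w" by blast
        then have "F.awalk v (e # p) w" "F.awalk v (e # q) w"
          using True e by (auto simp: F.awalk_Cons_iff)
        then have "fwd w (e # p) * bwd w (e # q) \<in> ?B v" using w by blast
        then show ?thesis unfolding b by (auto simp: mult.assoc intro: free.span_base)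
      qed
    qed
    moreover have "ed e * gh e \<approx> ed e * vx (head E e) * gh e"
      using e by (intro eqv_mult_right eqv_sym[OF ed_vx_head]) auto
    ultimately show ?thesis by (rule span_eqv[rotated])
  qed
  then have "(\<Sum>e \<in> out_arcs E v. ed e * gh e) \<in> free.span (?B v \<union> I)" by (rule free.span_sum)
  moreover have "v \<in> verts E" "v \<notin> sinks E" using step(1,2) sinks_F by auto
  ultimately show ?case using span_eqv[OF vx_sum] by blast
qed

lemma vx_in_span:
  assumes "v \<in> verts E"
  shows "vx v \<in> free.span (sink_monomials \<union> I)"
proof (cases "v \<in> verts F")
  case True
  from vx_in_span_aux[OF this] show ?thesis
    by (rule subsetD[OF free.span_mono, rotated]) (auto simp: sink_monomials_def)
next
  case False
  with assms show ?thesis by (auto intro: free.span_base)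
qed

text \<open>Modulo \<open>I\<close>, a generator on the left leaves \<open>q\<close> alone and acts
  on \<open>p\<close>: a vertex fixes or kills it, an edge prolongs or kills it, a ghost edge
  removes the first arc or kills it. A ghost edge meeting a trivial path kills it because
  \<open>w\<close> is a sink.\<close>

lemma gen_mult_sink_monomial:
  assumes x: "x \<in> lpa_gens E" and w: "w \<in> sinks F" and p: "F.awalk u p w" and q: "F.awalk v q w"
  shows "gen x * (fwd w p * bwd w q) \<in> free.span (sink_monomials \<union> I)"
proof -
  have qA: "bwd w q \<in> A" using q by (rule bwd_in_A)
  have pA: "fwd w p \<in> A" using p by (rule fwd_in_A)
  have I: "gen x * fwd w p \<in> I \<Longrightarrow> ?thesis"
    using qA by (auto simp: mult.assoc[symmetric] intro!: free.span_base alg_ideal.rmult)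
  have m: ?thesis if "gen x * fwd w p \<approx> fwd w p'" and "F.awalk u' p' w" for p' u'
  proof -
    have "gen x * fwd w p * bwd w q \<approx> fwd w p' * bwd w q"
      using that(1) qA by (rule eqv_mult_right)
    moreover have "fwd w p' * bwd w q \<in> free.span (sink_monomials \<union> I)"
      using sink_monomialsI[OF w that(2) q] by (auto intro: free.span_base)
    ultimately show ?thesis using span_eqv by (simp add: mult.assoc)
  qed
  show ?thesis
  proof (cases x)
    case (Vertex a)
    then show ?thesis
      using vx_fwd[OF p, of a] x m[OF _ p] I by (cases "a = u") (auto simp: eqv_zero_iff)
  next
    case (Edge e)
    then have e: "e \<in> arcs E" using x by simp
    show ?thesis
    proof (cases "e \<in> arcs F \<and> head E e = u")
      case True
      then have "F.awalk (tail E e) (e # p) w" using p by (auto simp: F.awalk_Cons_iff)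
      from m[OF _ this] show ?thesis by (simp add: Edge)
    next
      case False
      then have "ed e * fwd w p \<in> I"
        using ed_fwd_zero[OF p e] dead_arc(1)[OF e] e pA by (auto intro: alg_ideal.rmult)
      then show ?thesis using I Edge by simp
    qed
  next
    case (Ghost e)
    then have e: "e \<in> arcs E" using x by simp
    show ?thesis
    proof (cases p)
      case Nil
      then show ?thesis using gh_vx_sink[OF w e] I Ghost by simp
    next
      case (Cons f p')
      then have "F.awalk (head E f) p' w" using p by (simp add: F.awalk_Cons_iff)
      then show ?thesis
        using gh_fwd_Cons[OF p[unfolded Cons] e] m[of p'] I Cons Ghost
        by (cases "e = f") (auto simp: eqv_zero_iff)
    qed
  qed
qed

lemma gen_mult_span:
  assumes "x \<in> lpa_gens E" and "f \<in> free.span (sink_monomials \<union> I)"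
  shows "gen x * f \<in> free.span (sink_monomials \<union> I)"
proof -
  have "gen x * f * 1 \<in> free.span (sink_monomials \<union> I)"
    using assms(2)
  proof (rule span_mult_closed)
    fix b assume "b \<in> sink_monomials \<union> I"
    then show "gen x * b * 1 \<in> free.span (sink_monomials \<union> I)"
    proof
      assume "b \<in> I"
      then show ?thesis using assms(1) by (auto intro!: free.span_base alg_ideal.lmult)
    next
      assume "b \<in> sink_monomials"
      then show ?thesis
        using gen_mult_sink_monomial[OF assms(1)] by (auto simp: sink_monomials_def)
    qed
  qed
  then show ?thesis by simp
qed

text \<open>Words are built from the right, using closure of the span under left multiplication by
  generators. The base case is a single letter, since the empty word is not in \<open>A\<close>: an
  edge or ghost edge is replaced by its product with the vertex it absorbs on the right.\<close>

lemma A_subset_span: "A \<subseteq> free.span (sink_monomials \<union> I)"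
proof
  fix f assume "f \<in> A"
  then show "f \<in> free.span (sink_monomials \<union> I)"
  proof (induction rule: free_alg_induct)
    case zero
    then show ?case by (rule free.span_zero)
  next
    case (add f w c)
    have "Poly_Mapping.single w 1 \<in> free.span (sink_monomials \<union> I)"
      using add.hyps(2,3)
    proof (induction w)
      case (Cons x w)
      show ?case
      proof (cases "w = []")
        case True
        have x: "x \<in> lpa_gens E" using Cons.prems by simp
        have "gen x \<in> free.span (sink_monomials \<union> I)"
        proof (cases x)
          case (Vertex v)
          then show ?thesis using x vx_in_span by simp
        next
          case (Edge e)
          with x have e: "e \<in> arcs E" by simp
          then have "ed e * vx (head E e) \<in> free.span (sink_monomials \<union> I)"
            by (intro gen_mult_span vx_in_span) auto
          then show ?thesis using span_eqv[OF eqv_sym[OF ed_vx_head[OF e]]] Edge by simp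
        next
          case (Ghost e)
          with x have e: "e \<in> arcs E" by simp
          then have "gh e * vx (tail E e) \<in> free.span (sink_monomials \<union> I)"
            by (intro gen_mult_span vx_in_span) auto
          then show ?thesis using span_eqv[OF eqv_sym[OF gh_vx_tail[OF e]]] Ghost by simp
        qed
        then show ?thesis by (simp add: True gen_def)
      next
        case False
        then have "gen x * Poly_Mapping.single w 1 \<in> free.span (sink_monomials \<union> I)"
          using Cons by (intro gen_mult_span) auto
        then show ?thesis by (simp add: gen_def)
      qed
    qed simp
    then have "scale c (Poly_Mapping.single w 1) \<in> free.span (sink_monomials \<union> I)"
      by (rule free.span_scale)
    then have "Poly_Mapping.single w c \<in> free.span (sink_monomials \<union> I)"
      by (simp add: scale_def)
    then show ?case using add.IH by (rule free.span_add[rotated])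
  qed
qed

section \<open>Dimension count and uniqueness of the sink\<close>

text \<open>The images of \<open>B\<close> span the matrices, in which the \<open>n * n\<close>
  matrix units are independent.\<close>

lemma card_spanning_set:
  assumes "finite B" and "B \<subseteq> A" and "A \<subseteq> free.span (B \<union> I)"
  shows "n * n \<le> card B"
proof -
  let ?s = "\<lambda>(c :: 'k) (v :: nat \<times> nat \<Rightarrow> 'k) p. c * v p"
  interpret fs: vector_space ?s
    by unfold_locales (auto simp: fun_eq_iff algebra_simps)
  \<comment> \<open>The type \<open>'k mat\<close> holds matrices of all sizes and so is not itself
    a vector space; matrices are replaced by functions on index pairs, zero outside the
    \<open>n\<close> by \<open>n\<close> block.\<close>
  define ent where "ent f p = (if fst p < n \<and> snd p < n then \<Phi> f $$ p else 0)" for f p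
  define e :: "nat \<times> nat \<Rightarrow> nat \<times> nat \<Rightarrow> 'k" where "e p q = (if q = p then 1 else 0)" for p q
  let ?N = "{..<n} \<times> {..<n}"
  have ent_add: "ent (f + g) = ent f + ent g" if "f \<in> A" "g \<in> A" for f g
    using rep_carrier[OF that(1)] rep_carrier[OF that(2)]
    by (auto simp: fun_eq_iff ent_def rep_add[OF that])
  have ent_scale: "ent (scale c f) = ?s c (ent f)" if "f \<in> A" for c f
    using rep_carrier[OF that] by (auto simp: fun_eq_iff ent_def rep_scale[OF that])
  have ent_I: "ent f = 0" if "f \<in> I" for f
    using rep_eq_zero_iff[of f] that I_subset_A by (auto simp: fun_eq_iff ent_def)
  have sub: "free.subspace {f. f \<in> A \<and> ent f \<in> fs.span (ent ` B)}"
    using ent_I[OF alg_ideal.zero]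
    by (auto simp: free.subspace_def ent_add ent_scale fs.span_zero fs.span_add fs.span_scale)
  have span: "f \<in> A \<and> ent f \<in> fs.span (ent ` B)" if "f \<in> free.span (B \<union> I)" for f
    using that sub
  proof (rule free.span_induct)
    fix b assume "b \<in> B \<union> I"
    then show "b \<in> A \<and> ent b \<in> fs.span (ent ` B)"
      using assms(2) I_subset_A ent_I by (auto simp: fs.span_zero intro: fs.span_base)
  qed
  have e_eq_iff: "e q = e p \<longleftrightarrow> q = p" for p q
  proof
    assume "e q = e p"
    then have "e q q = e p q" by simp
    then show "q = p" by (simp add: e_def split: if_splits)
  qed simp
  have "e p \<in> fs.span (ent ` B)" if "p \<in> ?N" for p
  proof -
    have "mat n n (e p) \<in> carrier_mat n n" by simp
    then obtain f where "f \<in> A" "\<Phi> f = mat n n (e p)" using rep_surj by blast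
    then have "ent f = e p" using that by (auto simp: fun_eq_iff ent_def e_def)
    then show ?thesis using span[OF subsetD[OF assms(3) \<open>f \<in> A\<close>]] by simp
  qed
  moreover have "fs.independent (e ` ?N)"
  proof (rule fs.independent_if_scalars_zero)
    fix c x assume sum: "(\<Sum>v \<in> e ` ?N. ?s (c v) v) = 0" and "x \<in> e ` ?N"
    then obtain p where p: "p \<in> ?N" and x: "x = e p" by blast
    have ev: "(\<Sum>v\<in>S. ?s (c v) v) p = (\<Sum>v\<in>S. c v * v p)" for S
      by (induction S rule: infinite_finite_induct) auto
    have "0 = (\<Sum>v \<in> e ` ?N. c v * v p)" using fun_cong[OF sum, of p] ev by simp
    also have "\<dots> = (\<Sum>v \<in> e ` ?N. if v = x then c x else 0)"
    proof (intro sum.cong refl)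
      fix v assume "v \<in> e ` ?N"
      then obtain q where "v = e q" by blast
      then show "c v * v p = (if v = x then c x else 0)" using x e_eq_iff by (auto simp: e_def)
    qed
    also have "\<dots> = c x" using p x by (subst sum.delta) auto
    finally show "c x = 0" by simp
  qed simp
  ultimately have "card (e ` ?N) \<le> card (ent ` B)"
    using fs.independent_span_bound[of "ent ` B" "e ` ?N"] assms(1) by auto
  moreover have "inj_on e ?N" by (simp add: inj_on_def e_eq_iff)
  then have "card (e ` ?N) = n * n" by (simp add: card_image)
  ultimately show ?thesis using card_image_le[OF assms(1), of ent] by simp
qed

text \<open>The product survives only if \<open>p\<close> starts at \<open>s\<close> and
  \<open>q\<close> at \<open>t\<close>. Paths starting at sinks are trivial, so this would force
  \<open>s = w = t\<close>.\<close>

lemma sink_monomial_sandwich: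
  assumes s: "s \<in> sinks F" and t: "t \<in> sinks F" and "s \<noteq> t"
    and w: "w \<in> sinks F" and p: "F.awalk u p w" and q: "F.awalk v q w"
  shows "vx s * (fwd w p * bwd w q) * vx t \<in> I"
proof -
  have sE: "s \<in> verts E" "t \<in> verts E" using s t by (auto simp: sinks_def)
  have trivial: "p = []" if "F.awalk a p b" "a \<in> sinks F" for a p b
    using that by (cases p) (auto simp: F.awalk_Cons_iff sinks_def out_arcs_def)
  show ?thesis
  proof (cases "s = u \<and> t = v")
    case True
    then have "p = []" "q = []" using trivial p q s t by blast+
    then show ?thesis using p q True \<open>s \<noteq> t\<close> by (simp add: F.awalk_Nil_iff)
  next
    case False
    then consider "s \<noteq> u" | "t \<noteq> v" by blast
    then show ?thesis
    proof cases
      case 1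
      then have "vx s * fwd w p \<in> I" using vx_fwd[OF p sE(1)] by (simp add: eqv_zero_iff)
      then have "vx s * fwd w p * (bwd w q * vx t) \<in> I"
        using sE bwd_in_A[OF q] by (auto intro: alg_ideal.rmult[of "vx s * fwd w p"])
      then show ?thesis by (simp add: mult.assoc)
    next
      case 2
      then have "bwd w q * vx t \<in> I" using bwd_vx[OF q sE(2)] by (simp add: eqv_zero_iff)
      then have "vx s * fwd w p * (bwd w q * vx t) \<in> I"
        using sE fwd_in_A[OF p] by (intro alg_ideal.lmult[of "vx s * fwd w p"]) auto
      then show ?thesis by (simp add: mult.assoc)
    qed
  qed
qed

lemma sinks_F_unique:
  assumes s: "s \<in> sinks F" and t: "t \<in> sinks F"
  shows "s = t"
proof (rule ccontr)
  assume "s \<noteq> t"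
  have st: "s \<in> verts F" "t \<in> verts F" using s t by (auto simp: sinks_def)
  have sandwich: "vx s * f * vx t \<in> I" if "f \<in> A" for f
  proof -
    have "f \<in> free.span (sink_monomials \<union> I)" using that A_subset_span by blast
    then have "vx s * f * vx t \<in> free.span I"
    proof (rule span_mult_closed)
      fix b assume "b \<in> sink_monomials \<union> I"
      then have "vx s * b * vx t \<in> I"
      proof
        assume "b \<in> I"
        then show ?thesis using st by (intro I_sandwich) auto
      next
        assume "b \<in> sink_monomials"
        then show ?thesis
          using sink_monomial_sandwich[OF s t \<open>s \<noteq> t\<close>] by (auto simp: sink_monomials_def)
      qed
      then show "vx s * b * vx t \<in> free.span I" by (rule free.span_base)
    qed
    then show ?thesis using free.span_subspace[OF order_refl free.span_superset subspace_alg_ideal] by metis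
  qed
  have A: "vx s \<in> A" "vx t \<in> A" using st by auto
  have "\<Phi> (vx s) \<noteq> 0\<^sub>m n n" "\<Phi> (vx t) \<noteq> 0\<^sub>m n n" using A st by (simp_all add: rep_eq_zero_iff)
  with A obtain Q where Q: "Q \<in> carrier_mat n n" "\<Phi> (vx s) * Q * \<Phi> (vx t) \<noteq> 0\<^sub>m n n"
    using mat_sandwich_nonzero rep_carrier by metis
  then obtain f where f: "f \<in> A" "\<Phi> f = Q" using rep_surj by blast
  have "\<Phi> (vx s * f * vx t) = \<Phi> (vx s) * Q * \<Phi> (vx t)"
    using A f by (simp add: rep_mult)
  moreover have "\<Phi> (vx s * f * vx t) = 0\<^sub>m n n"
    using sandwich[OF f(1)] A f rep_eq_zero_iff[of "vx s * f * vx t"] by simp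
  ultimately show False using Q by simp
qed

lemma size_le_SP_max:
  assumes "n \<ge> 1"
  shows "n \<le> SP_max (card (arcs E))"
proof -
  \<comment> \<open>Without sinks there are no monomials, so the empty set spans and
    \<open>n * n\<close> would be 0.\<close>
  have "sinks F \<noteq> {}"
  proof
    assume "sinks F = {}"
    then have "sink_monomials = {}" by (simp add: sink_monomials_def)
    then show False using card_spanning_set[of "{}"] A_subset_span assms by simp
  qed
  then obtain w where w: "sinks F = {w}" using sinks_F_unique by blast
  let ?P = "paths_ending_in F w"
  have finP: "finite ?P" using F.paths_ending_in_bound(1)[OF acyclic_F w] .
  \<comment> \<open>Pairs of paths ending in \<open>w\<close> parametrise the monomials, which
    bounds their number by the square of the path count.\<close>
  let ?m = "\<lambda>((u, p), (v, q)). fwd w p * bwd w q"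
  have sub: "sink_monomials \<subseteq> ?m ` (?P \<times> ?P)"
  proof
    fix x assume "x \<in> sink_monomials"
    then obtain p q u v where "x = fwd w p * bwd w q" "F.awalk u p w" "F.awalk v q w"
      using w by (auto simp: sink_monomials_def)
    then show "x \<in> ?m ` (?P \<times> ?P)"
      by (intro image_eqI[of _ _ "((u, p), (v, q))"]) (auto simp: paths_ending_in_def)
  qed
  then have "finite sink_monomials" using finP by (auto intro: finite_subset)
  moreover have "sink_monomials \<subseteq> A"
    using fwd_in_A bwd_in_A by (auto simp: sink_monomials_def)
  ultimately have "n * n \<le> card sink_monomials" using A_subset_span by (rule card_spanning_set)
  also have "\<dots> \<le> card (?P \<times> ?P)" using sub finP by (intro surj_card_le) auto
  finally have "n\<^sup>2 \<le> (card ?P)\<^sup>2" by (simp add: card_cartesian_product power2_eq_square)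
  then have "n \<le> card ?P" by (rule power2_le_imp_le) simp
  also have "\<dots> \<le> SP_max (card (arcs F))" by (rule F.card_paths_le_SP_max[OF acyclic_F w])
  also have "\<dots> \<le> SP_max (card (arcs E))"
  proof (rule monoD[OF strict_mono_mono[OF strict_mono_SP_max]])
    show "card (arcs F) \<le> card (arcs E)" by (rule card_mono) auto
  qed
  finally show ?thesis .
qed

end

theorem corollary4p13:
  fixes E :: "('v, 'e) pre_digraph" and n :: nat
  assumes "n \<ge> 1"
    and "fin_digraph E"
    and "alg_iso (leavitt E :: ('k::field, (('v, 'e) lpa_gen list \<Rightarrow>\<^sub>0 'k) set) module)
                 (module_mat TYPE('k) n n)"
  shows "card (arcs E) \<ge> Max {N. n \<ge> SP_max N}"
proof -
  obtain \<Phi> :: "(('v, 'e) lpa_gen list \<Rightarrow>\<^sub>0 'k) \<Rightarrow> 'k mat" where "leavitt_matrix E n \<Phi>"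
    using assms(2,3) by (rule leavitt_matrixI)
  then have n: "n \<le> SP_max (card (arcs E))"
    using assms(1) by (rule leavitt_matrix.size_le_SP_max)
  have le: "N \<le> card (arcs E)" if "SP_max N \<le> n" for N
    using order_trans[OF that n] by (simp add: strict_mono_less_eq[OF strict_mono_SP_max])
  \<comment> \<open>\<open>Max\<close> is meaningful only on a finite nonempty set:
    \<open>le\<close> bounds this one, and it contains 0 because
    \<open>SP_max 0 = 1\<close>.\<close>
  then have "{N. n \<ge> SP_max N} \<subseteq> {..card (arcs E)}" by blast
  then have "finite {N. n \<ge> SP_max N}" by (rule finite_subset) simp
  moreover have "0 \<in> {N. n \<ge> SP_max N}" using assms(1) by (simp add: SP_max_0)
  ultimately show ?thesis using le by (subst Max_le_iff) auto
qed

end
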